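(* Let $A$ be a real $n\times n$ matrix such that $G=\{e^{tA}:t\in\mathbb{R}\}$ is a closed subgroup of $GL(n,\mathbb{R})$, $G\neq\{1_{n\times n}\}$, and the nonzero purely imaginary eigenvalues of $A$ (if any) span a one-dimensional vector space over $\mathbb{Q}$. Assume that $G$ acts freely in the set $\Omega\subset\mathbb{R}^n$ attached to $A$ in the context. Let $1\le p<\infty$, $m>2$, let $t_1,\dots,t_m$ be distinct real numbers, and let $c_1,\dots,c_m$ be complex scalars, not all zero. Then the equation $\sum_{k=1}^m c_k\phi(e^{t_kA}\cdot)=0$ has no nonzero solution $\phi$ in $L^p(\mathbb{R}^n)\cap C(\mathbb{R}^n)$.
   Context: $C(\mathbb{R}^n)$ is the set of continuous (complex-valued) functions on $\mathbb{R}^n$. $G$ acts on $\mathbb{R}^n$ by matrix-vector multiplication; it acts freely in a $G$-invariant set $\mathcal X$ if for all $v\in\mathcal X$, $e^{tA}v=e^{sA}v$ implies $t=s$. Definition of $\Omega$. Choose real linear coordinates on $\mathbb{R}^n=\mathbb{R}^p\times\mathbb{R}^q$ (here $p,q$ are the numbers of real and of non-real eigenvalues of $A$, counted with multiplicity) in which $A$ is in (lower) real Jordan form, and let $\iota:\mathbb{R}^p\times\mathbb{R}^q\to\mathbb{C}^p\times\mathbb{C}^q$, $\iota(v_1,\dots,v_p,w_1,\dots,w_q)=(v_1,\dots,v_p,w_1+iw_2,\dots,w_{q-1}+iw_q,w_1-iw_2,\dots,w_{q-1}-iw_q)$ (the identity if $q=0$). Then $\iota A\iota^{-1}$ is block diagonal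 with lower triangular blocks, each having a single eigenvalue on its diagonal and entries $0$ or $1$ on its subdiagonal (all other entries zero). Put $V=\iota(\mathbb{R}^n)$. (Under the freeness assumption $A$ is not diagonalizable over $\mathbb{C}$ with purely imaginary spectrum.) Then $\Omega=\iota^{-1}(\Omega_{\mathbb{C}})$, where: Case 1: if some block with eigenvalue $0$ is not diagonal, let $\mathbf k$ be the row index of its first nonzero subdiagonal entry and $\Omega_{\mathbb{C}}=\{v\in V:v_{\mathbf k-1}\neq0\}$. Case 2: if Case 1 fails and some eigenvalue has nonzero real part, order the coordinates so that $v_1$ is the first coordinate of a block with such an eigenvalue, and $\Omega_{\mathbb{C}}=\{v\in V:v_1\ne0\}$. Case 3: if Cases 1 and 2 fail, let $\mathbf k$ be the row index of the first nonzero subdiagonal entry of a non-diagonal block with nonzero eigenvalue and $\Omega_{\mathbb{C}}=\{v\in V:v_{\mathbf k-1}\ne0\}$. The set $\Omega$ is open, dense, co-null and $G$-invariant. *)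

theory Defs
  imports "HOL-Analysis.Analysis"
begin

text \<open>
  The type \<^typ>\<open>real^'n^'n\<close> carries the componentwise product, so the overloaded powers and
  exponential are not those of matrix algebra.
\<close>

primrec matpow :: "'a::semiring_1^'n^'n \<Rightarrow> nat \<Rightarrow> 'a^'n^'n" where
  "matpow A 0 = mat 1"
| "matpow A (Suc k) = A ** matpow A k"

definition matrix_exp :: "real^'n^'n \<Rightarrow> real^'n^'n" where
  "matrix_exp A = (\<Sum>k. (1 / fact k) *\<^sub>R matpow A k)"

definition one_param_group :: "real^'n^'n \<Rightarrow> (real^'n^'n) set" where
  "one_param_group A = range (\<lambda>t. matrix_exp (t *\<^sub>R A))"

definition general_linear_group :: "(real^'n^'n) set" where
  "general_linear_group = {M. invertible M}"

definition acts_freely_on :: "real^'n^'n \<Rightarrow> (real^'n) set \<Rightarrow> bool" where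
  "acts_freely_on A X \<longleftrightarrow>
     (\<forall>v\<in>X. \<forall>t s. matrix_exp (t *\<^sub>R A) *v v = matrix_exp (s *\<^sub>R A) *v v \<longrightarrow> t = s)"

definition complex_eigenvalues :: "real^'n^'n \<Rightarrow> complex set" where
  "complex_eigenvalues A = {\<mu>. \<exists>v. v \<noteq> 0 \<and> map_matrix complex_of_real A *v v = \<mu> *s v}"

definition imaginary_eigenvalues :: "real^'n^'n \<Rightarrow> complex set" where
  "imaginary_eigenvalues A = {\<mu> \<in> complex_eigenvalues A. Re \<mu> = 0 \<and> \<mu> \<noteq> 0}"

global_interpretation rat_complex: vector_space "\<lambda>(q::rat) (z::complex). of_rat q * z"
  by unfold_locales (simp_all add: algebra_simps of_rat_add of_rat_mult)

definition in_Lp :: "real \<Rightarrow> (real^'n \<Rightarrow> complex) \<Rightarrow> bool" where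
  "in_Lp p \<phi> \<longleftrightarrow>
     \<phi> \<in> borel_measurable lborel \<and> integrable lborel (\<lambda>x. norm (\<phi> x) powr p)"

text \<open>
  Coordinates and matrices in coordinates are indexed by natural numbers below \<open>n\<close>, starting from
  \<open>0\<close>; values at other indices are irrelevant. Rows and columns \<open>a, \<dots>, b - 1\<close> of \<open>J\<close> form a diagonal
  block with eigenvalue \<open>\<mu>\<close>. As several adjacent elementary Jordan blocks with the same eigenvalue may
  be taken together, zeros are allowed on the subdiagonal of a block.
\<close>

definition jordan_block_at ::
    "nat \<Rightarrow> (nat \<Rightarrow> nat \<Rightarrow> 'a::zero_neq_one) \<Rightarrow> nat \<Rightarrow> nat \<Rightarrow> 'a \<Rightarrow> bool" where
  "jordan_block_at n J a b \<mu> \<longleftrightarrow>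
     a < b \<and> b \<le> n \<and>
     (\<forall>i\<in>{a..<b}. \<forall>j\<in>{a..<b}.
        (i = j \<longrightarrow> J i j = \<mu>) \<and>
        (i = Suc j \<longrightarrow> J i j \<in> {0, 1}) \<and>
        (i \<noteq> j \<and> i \<noteq> Suc j \<longrightarrow> J i j = 0)) \<and>
     (\<forall>i\<in>{a..<b}. \<forall>j<n. j \<notin> {a..<b} \<longrightarrow> J i j = 0 \<and> J j i = 0)"

definition lower_jordan_form :: "nat \<Rightarrow> (nat \<Rightarrow> nat \<Rightarrow> 'a::zero_neq_one) \<Rightarrow> bool" where
  "lower_jordan_form n J \<longleftrightarrow> (\<forall>i<n. \<exists>a b \<mu>. i \<in> {a..<b} \<and> jordan_block_at n J a b \<mu>)"

text \<open>
  The number of real eigenvalues is \<open>r\<close>, the number of non-real ones is \<open>2 * h\<close>. The non-real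
  part consists of the \<open>2 \<times> 2\<close> real blocks representing multiplication by the entries of a complex
  Jordan matrix \<open>C\<close>.
\<close>

definition lower_real_jordan_form :: "nat \<Rightarrow> nat \<Rightarrow> (nat \<Rightarrow> nat \<Rightarrow> real) \<Rightarrow> bool" where
  "lower_real_jordan_form r h J \<longleftrightarrow>
     lower_jordan_form r J \<and>
     (\<exists>C :: nat \<Rightarrow> nat \<Rightarrow> complex.
        lower_jordan_form h C \<and> (\<forall>i<h. Im (C i i) \<noteq> 0) \<and>
        (\<forall>i<h. \<forall>j<h.
           J (r + 2 * i) (r + 2 * j) = Re (C i j) \<and>
           J (r + 2 * i) (r + 2 * j + 1) = - Im (C i j) \<and>
           J (r + 2 * i + 1) (r + 2 * j) = Im (C i j) \<and>
           J (r + 2 * i + 1) (r + 2 * j + 1) = Re (C i j))) \<and>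
     (\<forall>i<r. \<forall>j\<in>{r..<r + 2 * h}. J i j = 0 \<and> J j i = 0)"

definition linear_coordinates :: "(real^'n \<Rightarrow> nat \<Rightarrow> real) \<Rightarrow> bool" where
  "linear_coordinates X \<longleftrightarrow>
     (\<forall>i<CARD('n). linear (\<lambda>v. X v i)) \<and>
     bij_betw (\<lambda>v. restrict (X v) {..<CARD('n)}) UNIV ({..<CARD('n)} \<rightarrow>\<^sub>E UNIV)"

definition matrix_in_coordinates ::
    "real^'n^'n \<Rightarrow> (real^'n \<Rightarrow> nat \<Rightarrow> real) \<Rightarrow> (nat \<Rightarrow> nat \<Rightarrow> real) \<Rightarrow> bool" where
  "matrix_in_coordinates A X J \<longleftrightarrow>
     (\<forall>v. \<forall>i<CARD('n). X (A *v v) i = (\<Sum>j<CARD('n). J i j * X v j))"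

definition iota :: "nat \<Rightarrow> nat \<Rightarrow> (nat \<Rightarrow> real) \<Rightarrow> nat \<Rightarrow> complex" where
  "iota r h v i =
     (if i < r then complex_of_real (v i)
      else if i < r + h then
        complex_of_real (v (r + 2 * (i - r))) + \<i> * complex_of_real (v (r + 2 * (i - r) + 1))
      else
        complex_of_real (v (r + 2 * (i - r - h)))
          - \<i> * complex_of_real (v (r + 2 * (i - r - h) + 1)))"

text \<open>
  \<open>M\<close> is the matrix of the conjugate of \<open>J\<close> by \<^const>\<open>iota\<close>. It is unique, as the image of
  \<^const>\<open>iota\<close> spans the complex coordinate space.
\<close>

definition iota_conjugate ::
    "nat \<Rightarrow> nat \<Rightarrow> (nat \<Rightarrow> nat \<Rightarrow> real) \<Rightarrow> (nat \<Rightarrow> nat \<Rightarrow> complex) \<Rightarrow> bool" where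
  "iota_conjugate r h J M \<longleftrightarrow>
     (\<forall>v. \<forall>i<r + 2 * h.
        iota r h (\<lambda>k. \<Sum>j<r + 2 * h. J k j * v j) i = (\<Sum>j<r + 2 * h. M i j * iota r h v j))"

definition first_subdiagonal_row ::
    "(nat \<Rightarrow> nat \<Rightarrow> complex) \<Rightarrow> nat \<Rightarrow> nat \<Rightarrow> nat \<Rightarrow> bool" where
  "first_subdiagonal_row M a b k \<longleftrightarrow>
     k \<in> {a<..<b} \<and> M k (k - 1) \<noteq> 0 \<and> (\<forall>j\<in>{a<..<k}. M j (j - 1) = 0)"

text \<open>
  The possible indices of the coordinate whose nonvanishing defines \<open>\<Omega>\<close>. In the second case it is the
  first coordinate of a block, wherever that block stands; no reordering of coordinates is needed.
\<close>

definition omega_index :: "nat \<Rightarrow> (nat \<Rightarrow> nat \<Rightarrow> complex) \<Rightarrow> nat \<Rightarrow> bool" where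
  "omega_index n M \<kappa> \<longleftrightarrow>
     (if \<exists>a b k. jordan_block_at n M a b 0 \<and> first_subdiagonal_row M a b k
      then \<exists>a b k. jordan_block_at n M a b 0 \<and> first_subdiagonal_row M a b k \<and> \<kappa> = k - 1
      else if \<exists>a b \<mu>. jordan_block_at n M a b \<mu> \<and> Re \<mu> \<noteq> 0
      then \<exists>a b \<mu>. jordan_block_at n M a b \<mu> \<and> Re \<mu> \<noteq> 0 \<and> \<kappa> = a
      else \<exists>a b \<mu> k. jordan_block_at n M a b \<mu> \<and> \<mu> \<noteq> 0 \<and>
             first_subdiagonal_row M a b k \<and> \<kappa> = k - 1)"

text \<open>
  \<open>\<Omega>\<close> depends on the choice of the coordinates and of the block, hence is given by a relation.
  No \<open>\<Omega>\<close> is attached to \<open>A\<close> if \<open>A\<close> is diagonalizable over the complex numbers with purely imaginary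
  spectrum.
\<close>

definition is_Omega :: "real^'n^'n \<Rightarrow> (real^'n) set \<Rightarrow> bool" where
  "is_Omega A \<Omega> \<longleftrightarrow>
     (\<exists>X r h J M \<kappa>.
        r + 2 * h = CARD('n) \<and>
        linear_coordinates X \<and> matrix_in_coordinates A X J \<and>
        lower_real_jordan_form r h J \<and> iota_conjugate r h J M \<and>
        omega_index (r + 2 * h) M \<kappa> \<and>
        \<Omega> = {v. iota r h (X v) \<kappa> \<noteq> 0})"

end

theory Submission
  imports Defs "HOL-Complex_Analysis.Complex_Analysis" "HOL-Real_Asymp.Real_Asymp"
begin

text \<open>
  In each of the three cases the coordinate \<open>l\<close> defining \<open>\<Omega>\<close> satisfies \<open>l (A v) = \<mu> l v\<close>, and either
  \<open>Re \<mu> \<noteq> 0\<close> or the next coordinate \<open>l'\<close> of the block satisfies \<open>l' (A v) = \<mu> l' v + l v\<close>. Hence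
  \<open>\<tau> = ln |l| / Re \<mu>\<close>, respectively \<open>\<tau> = Re (l' / l)\<close>, increases by \<open>t\<close> under \<open>exp (t A)\<close>. As \<open>exp (t A)\<close>
  scales Lebesgue measure by an exponential in \<open>t\<close>, Fubini on the sets \<open>{|\<tau>| \<le> k}\<close> shows that
  for almost every \<open>x\<close> the function \<open>\<phi> (exp (t A) x)\<close>, times an exponential, is in \<open>L\<^sup>p\<close> of the line, and it
  satisfies a linear relation between its translates. There such a relation forces the
  function to vanish: after averaging it is bounded and tends to \<open>0\<close>; its one-sided Laplace transforms are
  both given by the same quotient of entire functions, which has no poles, because the function
  decays, and is bounded by \<open>C / |Re z|\<close>, hence is zero.
\<close>

section \<open>Translates of a function on the line\<close>

text \<open>The obstacle on the line is the imaginary axis. If the exponential sum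
  \<open>Q z = (\<Sum>k\<in>I. c k * exp (z * t k))\<close> vanishes at z = \<i> b, then h s = exp
  (\<i> b s) is a bounded solution of the relation, so boundedness alone cannot suffice: it bounds
  the quotient by C / |Re z|, which still permits a simple pole on the axis. Decay at one end
  excludes that pole, because Re z times the transform of |h| tends to 0 as Re z tends to 0 from the
  right. A continuous L^p function need not have this decay, but its averages over [x, x + e] do.
  The role of \<tau> is to make orbits leave every slab {|\<tau>| \<le> k} after a time of at most 2
  k. Along a periodic orbit on which \<phi> is not zero, the integral of |\<phi>|^p would diverge
  under every exponential weight. The weight itself is harmless: it replaces \<open>c k\<close> by
  \<open>c k * exp (a * t k / p)\<close>, so the times stay distinct and the coefficients stay not
  all zero.\<close>

lemma AE_zero_continuous_imp_zero:
  fixes f :: "'a::euclidean_space \<Rightarrow> 'b::{t1_space, zero}"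
  assumes "open S" "continuous_on S f" "AE x in lborel. x \<in> S \<longrightarrow> f x = 0" "x \<in> S"
  shows "f x = 0"
proof (rule ccontr)
  assume "f x \<noteq> 0"
  have "open (S \<inter> f -` (- {0}))"
    using assms by (metis Int_commute continuous_on_open_vimage open_Compl closed_singleton)
  moreover have "negligible (S \<inter> f -` (- {0}))"
  proof -
    have "AE x in lebesgue. x \<notin> S \<inter> f -` (- {0})"
      using AE_completion[OF assms(3)] by eventually_elim auto
    then show ?thesis
      by (simp add: negligible_iff_null_sets AE_iff_null_sets calculation)
  qed
  ultimately show False
    using open_not_negligible \<open>f x \<noteq> 0\<close> \<open>x \<in> S\<close> by blast
qed

text \<open>On \<open>|w| = R\<close> one has \<open>|w\<^sup>2 + R\<^sup>2| = 2 R |Re w|\<close>, so this factor compensates the blow-up of the bound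
  at the imaginary axis.\<close>

lemma entire_Re_bound_imp_zero:
  fixes G :: "complex \<Rightarrow> complex"
  assumes hol: "G holomorphic_on UNIV"
    and bound: "\<And>z. \<bar>Re z\<bar> * norm (G z) \<le> C"
  shows "G z = 0"
proof -
  have C: "C \<ge> 0"
    using bound[of 0] by simp
  have *: "norm (G z) \<le> 2 * C * R / (R\<^sup>2 - (norm z)\<^sup>2)" if R: "norm z < R" for R
  proof -
    have R0: "0 < R" "(norm z)\<^sup>2 < R\<^sup>2"
      using R by (auto intro!: power_strict_mono le_less_trans[OF norm_ge_zero R])
    have "norm ((z\<^sup>2 + of_real (R\<^sup>2)) * G z) \<le> 2 * C * R"
    proof (rule maximum_modulus_frontier[of "\<lambda>w. (w\<^sup>2 + of_real (R\<^sup>2)) * G w" "cball 0 R"])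
      show "(\<lambda>w. (w\<^sup>2 + of_real (R\<^sup>2)) * G w) holomorphic_on interior (cball 0 R)"
        by (intro holomorphic_intros holomorphic_on_subset[OF hol]) auto
      show "continuous_on (closure (cball 0 R)) (\<lambda>w. (w\<^sup>2 + of_real (R\<^sup>2)) * G w)"
        by (intro continuous_intros holomorphic_on_imp_continuous_on holomorphic_on_subset[OF hol]) auto
      show "norm ((w\<^sup>2 + of_real (R\<^sup>2)) * G w) \<le> 2 * C * R" if "w \<in> frontier (cball 0 R)" for w
      proof -
        have w: "norm w = R" using that R0 by simp
        have "w\<^sup>2 + of_real (R\<^sup>2) = w * w + w * cnj w"
          using complex_norm_square[of w] w by (simp add: power2_eq_square)
        also have "\<dots> = of_real (2 * Re w) * w"
          by (metis complex_add_cnj distrib_left mult.commute)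
        finally have "norm (w\<^sup>2 + of_real (R\<^sup>2)) = 2 * \<bar>Re w\<bar> * R"
          by (simp add: norm_mult w)
        then have "norm ((w\<^sup>2 + of_real (R\<^sup>2)) * G w) = 2 * R * (\<bar>Re w\<bar> * norm (G w))"
          by (simp add: norm_mult)
        also have "\<dots> \<le> 2 * R * C"
          using bound[of w] R0 by (intro mult_left_mono) auto
        finally show ?thesis by (simp add: mult_ac)
      qed
    qed (use R in auto)
    moreover have "R\<^sup>2 - (norm z)\<^sup>2 \<le> norm (z\<^sup>2 + of_real (R\<^sup>2))"
      using norm_diff_ineq[of "of_real (R\<^sup>2)" "z\<^sup>2"] R0 by (simp add: norm_power add.commute)
    ultimately have "(R\<^sup>2 - (norm z)\<^sup>2) * norm (G z) \<le> 2 * C * R"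
      by (smt (verit) mult_right_mono norm_ge_zero norm_mult)
    then show ?thesis
      using R0 by (simp add: field_simps)
  qed
  \<comment> \<open>For fixed z the bound is O(1 / R), so letting the circle grow forces
    \<open>G z = 0\<close>.\<close>
  have "((\<lambda>R. 2 * C * R / (R\<^sup>2 - (norm z)\<^sup>2)) \<longlongrightarrow> 0) at_top"
    by real_asymp
  moreover have "\<forall>\<^sub>F R in at_top. norm (G z) \<le> 2 * C * R / (R\<^sup>2 - (norm z)\<^sup>2)"
    using eventually_gt_at_top[of "norm z"] by eventually_elim (rule *)
  ultimately have "norm (G z) \<le> 0"
    by (rule tendsto_lowerbound) auto
  then show ?thesis by simp
qed

section \<open>Removable singularities and quotients of entire functions\<close>

lemma tendsto_mult_imp_removable:
  fixes f :: "complex \<Rightarrow> complex"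
  assumes "isolated_singularity_at f z" "((\<lambda>w. (w - z) * f w) \<longlongrightarrow> 0) (at z)"
  obtains c where "(f \<longlongrightarrow> c) (at z)"
proof -
  from assms(1) obtain A where A: "open A" "z \<in> A" "f holomorphic_on (A - {z})"
    using analytic_imp_holomorphic isolated_singularity_at_iff_analytic_nhd by auto
  \<comment> \<open>Riemann's criterion: the limit 0 of the product, as opposed to mere boundedness,
    excludes a simple pole.\<close>
  obtain g where g: "g holomorphic_on A" "\<forall>w\<in>A - {z}. g w = f w"
    using holomorphic_on_extend_lim[of f A z] A assms(2) by (auto simp: interior_open)
  have "(g \<longlongrightarrow> g z) (at z)"
    using g(1) A by (metis at_within_open continuous_on holomorphic_on_imp_continuous_on)
  moreover have "\<forall>\<^sub>F w in at z. g w = f w"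
    using eventually_at_in_open[OF A(1,2)] by eventually_elim (use g(2) in auto)
  ultimately show ?thesis
    by (intro that[of "g z"]) (rule Lim_transform_eventually)
qed

text \<open>Zeros of \<open>Q\<close> are isolated because \<open>Q b\<close> is nonzero, so P / Q
  has only poles or removable singularities. Off the imaginary axis the bound C / |Re z| excludes
  poles. On the axis it would allow simple ones, and there the vanishing of \<open>B\<close> at 0
  takes over. The extended quotient falls under \<open>entire_Re_bound_imp_zero\<close>.\<close>

lemma entire_quotient_zero:
  fixes P Q :: "complex \<Rightarrow> complex" and B :: "real \<Rightarrow> real"
  assumes P: "P holomorphic_on UNIV" and Q: "Q holomorphic_on UNIV" and "Q b \<noteq> 0"
    and bound: "\<And>z. \<bar>Re z\<bar> * norm (P z) \<le> C * norm (Q z)"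
    and B: "(B \<longlongrightarrow> 0) (at_right 0)"
      "\<And>z. Re z > 0 \<Longrightarrow> Re z * norm (P z) \<le> B (Re z) * norm (Q z)"
    and "Q z \<noteq> 0"
  shows "P z = 0"
proof -
  define f where "f = (\<lambda>z. P z / Q z)"
  have anP: "P analytic_on {w}" and anQ: "Q analytic_on {w}" for w
    using P Q by (auto simp: analytic_on_open[symmetric] intro: analytic_on_subset)
  have iso: "isolated_singularity_at f w" for w
    unfolding f_def
    by (intro singularity_intros isolated_singularity_at_analytic not_essential_analytic anP anQ)
  have nz: "\<forall>\<^sub>F w in at v. Q w \<noteq> 0" for v
    using non_zero_neighbour_alt[OF Q open_UNIV connected_UNIV _ _ \<open>Q b \<noteq> 0\<close>, of v] by simp
  have lim: "\<exists>c. (f \<longlongrightarrow> c) (at v)" for v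
  proof (cases "Re v = 0")
    case False
    have ne: "not_essential f v"
      unfolding f_def
      by (intro singularity_intros isolated_singularity_at_analytic not_essential_analytic anP anQ)
    have "\<not> is_pole f v"
    proof
      assume "is_pole f v"
      then have "filterlim f at_infinity (at v)" by (simp add: is_pole_def)
      moreover have "((\<lambda>w. complex_of_real \<bar>Re w\<bar>) \<longlongrightarrow> of_real \<bar>Re v\<bar>) (at v)"
        by (intro tendsto_intros)
      ultimately have "filterlim (\<lambda>w. complex_of_real \<bar>Re w\<bar> * f w) at_infinity (at v)"
        using False by (intro tendsto_mult_filterlim_at_infinity) auto
      then have "\<forall>\<^sub>F w in at v. norm (complex_of_real \<bar>Re w\<bar> * f w) \<ge> C + 1"
        by (metis filterlim_at_infinity_imp_norm_at_top filterlim_at_top)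
      then have "\<forall>\<^sub>F w in at v. False"
        using nz[of v]
      proof eventually_elim
        case (elim w)
        have "norm (complex_of_real \<bar>Re w\<bar> * f w) \<le> C"
          using bound[of w] elim(2) by (simp add: f_def norm_mult norm_divide field_simps)
        then show ?case using elim(1) by simp
      qed
      then show False by simp
    qed
    then show ?thesis using ne by (auto simp: not_essential_def)
  next
    case True
    \<comment> \<open>A quotient of analytic functions has a limit at \<open>v\<close>, finite or
      infinite, so the single horizontal path v + x with x > 0 decides it. As Re v = 0, the real
      part on this path is x, and \<open>B\<close> applies.\<close>
    define g where "g = (\<lambda>w. (w - v) * P w / Q w)"
    have g_alt: "g = (\<lambda>w. (w - v) * f w)" by (simp add: g_def f_def)
    have "not_essential g v"
      unfolding g_def
      by (intro singularity_intros isolated_singularity_at_analytic not_essential_analytic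
           analytic_intros anP anQ)
    have path: "filterlim (\<lambda>x. v + of_real x) (at v) (at_right 0)"
      unfolding filterlim_at
      by (auto intro!: tendsto_eq_intros simp: eventually_at_right_less eventually_at_filter)
    have g0: "((\<lambda>x. g (v + of_real x)) \<longlongrightarrow> 0) (at_right 0)"
    proof (rule Lim_null_comparison[OF _ B(1)])
      have "\<forall>\<^sub>F x in at_right 0. Q (v + of_real x) \<noteq> 0"
        using eventually_compose_filterlim[OF nz path] .
      moreover have "\<forall>\<^sub>F x in at_right (0::real). x > 0" by (rule eventually_at_right_less)
      ultimately show "\<forall>\<^sub>F x in at_right 0. norm (g (v + of_real x)) \<le> B x"
      proof eventually_elim
        case (elim x)
        then show ?case
          using B(2)[of "v + of_real x"] True by (simp add: g_def norm_mult norm_divide field_simps)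
      qed
    qed
    from \<open>not_essential g v\<close> obtain c where "(g \<longlongrightarrow> c) (at v) \<or> is_pole g v"
      by (auto simp: not_essential_def)
    then have "(g \<longlongrightarrow> 0) (at v)"
    proof
      assume c: "(g \<longlongrightarrow> c) (at v)"
      then have "((\<lambda>x. g (v + of_real x)) \<longlongrightarrow> c) (at_right 0)"
        using path by (rule filterlim_compose)
      then have "c = 0"
        using g0 tendsto_unique trivial_limit_at_right_real by blast
      then show "(g \<longlongrightarrow> 0) (at v)" using c by simp
    next
      assume "is_pole g v"
      then have "filterlim (\<lambda>x. g (v + of_real x)) at_infinity (at_right 0)"
        unfolding is_pole_def using path by (rule filterlim_compose)
      then show "(g \<longlongrightarrow> 0) (at v)"
        using g0 not_tendsto_and_filterlim_at_infinity trivial_limit_at_right_real by blast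
    qed
    then show ?thesis
      using tendsto_mult_imp_removable[OF iso] unfolding g_alt by blast
  qed
  \<comment> \<open>Division by zero gives \<open>f\<close> the value 0 at the zeros of
    \<open>Q\<close>, so \<open>f\<close> itself may be discontinuous there;
    \<open>remove_sings\<close> puts the limit in place of each such value.\<close>
  define G where "G = remove_sings f"
  have anG: "G analytic_on UNIV"
    unfolding G_def using lim remove_sings_analytic_at[OF iso] analytic_on_analytic_at by blast
  have ev: "\<forall>\<^sub>F w in at v. G w = f w" for v
    unfolding G_def using eventually_remove_sings_eq_at[OF iso] .
  have "\<bar>Re v\<bar> * norm (G v) \<le> C" for v
  proof (rule tendsto_upperbound)
    have "isCont G v"
      using anG by (simp add: analytic_at_imp_isCont analytic_on_subset)
    then show "((\<lambda>w. \<bar>Re w\<bar> * norm (G w)) \<longlongrightarrow> \<bar>Re v\<bar> * norm (G v)) (at v)"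
      by (auto intro!: tendsto_intros simp: isCont_def)
    show "\<forall>\<^sub>F w in at v. \<bar>Re w\<bar> * norm (G w) \<le> C"
      using ev[of v] nz[of v]
    proof eventually_elim
      case (elim w)
      have "\<bar>Re w\<bar> * norm (f w) \<le> C"
        using bound[of w] elim(2) by (simp add: f_def norm_divide field_simps)
      then show ?case using elim(1) by simp
    qed
  qed auto
  then have "G z = 0"
    using anG entire_Re_bound_imp_zero by (metis analytic_imp_holomorphic)
  moreover have "f analytic_on {z}"
    unfolding f_def using \<open>Q z \<noteq> 0\<close> by (intro analytic_intros anP anQ) auto
  ultimately have "f z = 0"
    by (simp add: G_def)
  then show ?thesis using \<open>Q z \<noteq> 0\<close> by (simp add: f_def)
qed

section \<open>One-sided Laplace transforms of bounded functions\<close>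

definition laplace :: "(real \<Rightarrow> complex) \<Rightarrow> complex \<Rightarrow> complex" where
  "laplace h z = (LINT t:{0..}|lborel. h t * exp (- z * of_real t))"

lemma has_bochner_integral_exp_decay:
  fixes x :: real
  assumes "x > 0"
  shows "has_bochner_integral lborel (\<lambda>t. indicator {0..} t * exp (- x * t)) (1 / x)"
proof -
  have "(\<integral>\<^sup>+t. ennreal (exp (- x * t)) * indicator {0..} t \<partial>lborel) = ennreal (0 - (- exp (- x * 0) / x))"
  proof (rule nn_integral_FTC_atLeast)
    show "((\<lambda>t. - exp (- x * t) / x) has_real_derivative exp (- x * t)) (at t)" for t
      using assms by (auto intro!: derivative_eq_intros)
    show "((\<lambda>t. - exp (- x * t) / x) \<longlongrightarrow> 0) at_top"
      using assms by real_asymp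
  qed auto
  then have "(\<integral>\<^sup>+t. ennreal (indicator {0..} t * exp (- x * t)) \<partial>lborel) = ennreal (1 / x)"
    by (simp add: indicator_mult_ennreal mult.commute[of _ "indicator {0..} _"])
  then show ?thesis
    using assms by (intro has_bochner_integral_nn_integral) auto
qed

lemmas integrable_exp_decay = integrable.intros[OF has_bochner_integral_exp_decay]

text \<open>The end point \<open>a\<close> may be negative, since shifts move the half line to
  either side; the compact piece {a..0} is then added to {0..}.\<close>

lemma set_integrable_laplace:
  fixes h :: "real \<Rightarrow> complex"
  assumes "h \<in> borel_measurable borel" "\<And>t. norm (h t) \<le> C" "Re z > 0"
  shows "set_integrable lborel {a..} (\<lambda>t. h t * exp (- z * of_real t))"
proof -
  have [measurable]: "h \<in> borel_measurable borel" by fact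
  have C: "C \<ge> 0" using assms(2)[of 0] norm_ge_zero order_trans by blast
  have 1: "set_integrable lborel {0..} (\<lambda>t. h t * exp (- z * of_real t))"
    unfolding set_integrable_def
  proof (rule Bochner_Integration.integrable_bound)
    show "integrable lborel (\<lambda>t. C * (indicator {0..} t * exp (- Re z * t)))"
      by (intro integrable_mult_right integrable_exp_decay assms)
    show "AE t in lborel. norm (indicator {0..} t *\<^sub>R (h t * exp (- z * of_real t)))
            \<le> norm (C * (indicator {0..} t * exp (- Re z * t)))"
      using C assms(2) by (intro AE_I2) (auto simp: norm_mult indicator_def intro!: mult_mono)
  qed simp
  have 2: "set_integrable lborel {a..b} (\<lambda>t. h t * exp (- z * of_real t))" for a b
    unfolding set_integrable_def
  proof (rule Bochner_Integration.integrable_bound)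
    have "set_integrable lborel {a..b} (\<lambda>t. C * exp (- Re z * t))"
      by (intro borel_integrable_atLeastAtMost' continuous_intros)
    then show "integrable lborel (\<lambda>t. indicator {a..b} t *\<^sub>R (C * exp (- Re z * t)))"
      by (simp add: set_integrable_def)
    show "AE t in lborel. norm (indicator {a..b} t *\<^sub>R (h t * exp (- z * of_real t)))
            \<le> norm (indicator {a..b} t *\<^sub>R (C * exp (- Re z * t)))"
      using C assms(2) by (intro AE_I2) (auto simp: norm_mult indicator_def intro!: mult_mono)
  qed simp
  have "set_integrable lborel ({0..} \<union> {a..0}) (\<lambda>t. h t * exp (- z * of_real t))"
    by (intro set_integrable_Un 1 2) auto
  then show ?thesis
    by (rule set_integrable_subset) auto
qed

text \<open>The middle quantity depends on \<open>z\<close> only through \<open>Re z\<close>. It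
  later plays the part of \<open>B\<close> in \<open>entire_quotient_zero\<close>, while the two
  inequalities chained give the constant \<open>C\<close> there.\<close>

lemma norm_laplace_le:
  fixes h :: "real \<Rightarrow> complex"
  assumes [measurable]: "h \<in> borel_measurable borel" and "\<And>t. norm (h t) \<le> C" "Re z > 0"
  shows "Re z * norm (laplace h z) \<le> Re z * (LINT t:{0..}|lborel. norm (h t) * exp (- Re z * t))"
    and "Re z * (LINT t:{0..}|lborel. norm (h t) * exp (- Re z * t)) \<le> C"
proof -
  have C: "C \<ge> 0" using assms(2)[of 0] norm_ge_zero order_trans by blast
  have int: "set_integrable lborel {0..} (\<lambda>t. h t * exp (- z * of_real t))"
    by (rule set_integrable_laplace) (use assms in auto)
  have "norm (laplace h z) \<le> (LINT t:{0..}|lborel. norm (h t * exp (- z * of_real t)))"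
    unfolding laplace_def by (rule set_integral_norm_bound) (rule int)
  also have "\<dots> = (LINT t:{0..}|lborel. norm (h t) * exp (- Re z * t))"
    by (simp add: norm_mult)
  finally show "Re z * norm (laplace h z) \<le> Re z * (LINT t:{0..}|lborel. norm (h t) * exp (- Re z * t))"
    using assms by simp
  have "(LINT t:{0..}|lborel. norm (h t) * exp (- Re z * t)) \<le> (LINT t|lborel. C * (indicator {0..} t * exp (- Re z * t)))"
    unfolding set_lebesgue_integral_def
  proof (rule integral_mono)
    show "integrable lborel (\<lambda>t. indicator {0..} t *\<^sub>R (norm (h t) * exp (- Re z * t)))"
      using set_integrable_norm[OF int] by (simp add: set_integrable_def norm_mult)
    show "integrable lborel (\<lambda>t. C * (indicator {0..} t * exp (- Re z * t)))"
      by (intro integrable_mult_right integrable_exp_decay assms)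
  qed (use C assms(2) in \<open>auto simp: indicator_def intro!: mult_mono\<close>)
  also have "\<dots> = C / Re z"
    using has_bochner_integral_integral_eq[OF has_bochner_integral_exp_decay[OF \<open>Re z > 0\<close>]] by simp
  finally show "Re z * (LINT t:{0..}|lborel. norm (h t) * exp (- Re z * t)) \<le> C"
    using assms by (simp add: field_simps)
qed

text \<open>The function x * exp (- x t) is a probability density on the half line whose mass
  escapes to infinity as x tends to 0, so the mean of |h| tends to the limit of |h|. The part before
  \<open>T\<close> contributes at most \<open>x * (C * T)\<close>, the tail at most
  \<open>e / 2\<close>.\<close>

lemma laplace_abelian:
  fixes h :: "real \<Rightarrow> complex"
  assumes [measurable]: "h \<in> borel_measurable borel" and "\<And>t. norm (h t) \<le> C"
    and "(h \<longlongrightarrow> 0) at_top"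
  shows "((\<lambda>x. x * (LINT t:{0..}|lborel. norm (h t) * exp (- x * t))) \<longlongrightarrow> 0) (at_right 0)"
proof (rule tendstoI)
  fix e :: real assume "e > 0"
  have C: "C \<ge> 0" using assms(2)[of 0] norm_ge_zero order_trans by blast
  obtain T where T: "T \<ge> 0" "\<And>t. t \<ge> T \<Longrightarrow> norm (h t) \<le> e / 2"
  proof -
    have "\<forall>\<^sub>F t in at_top. norm (h t) < e / 2"
      using tendstoD[OF assms(3), of "e / 2"] \<open>e > 0\<close> by simp
    then obtain T where "\<And>t. t \<ge> T \<Longrightarrow> norm (h t) < e / 2"
      by (auto simp: eventually_at_top_linorder)
    then show ?thesis by (intro that[of "max T 0"]) (auto intro: less_imp_le)
  qed
  have le: "x * (LINT t:{0..}|lborel. norm (h t) * exp (- x * t)) \<le> x * (C * T) + e / 2" if "x > 0" for x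
  proof -
    have "(LINT t:{0..}|lborel. norm (h t) * exp (- x * t))
        \<le> (LINT t|lborel. C * indicator {0..T} t + e / 2 * (indicator {0..} t * exp (- x * t)))"
      unfolding set_lebesgue_integral_def
    proof (rule integral_mono)
      have "set_integrable lborel {0..} (\<lambda>t. h t * exp (- of_real x * of_real t))"
        by (rule set_integrable_laplace) (use assms that in auto)
      from set_integrable_norm[OF this]
      show "integrable lborel (\<lambda>t. indicator {0..} t *\<^sub>R (norm (h t) * exp (- x * t)))"
        by (simp add: set_integrable_def norm_mult)
      show "integrable lborel (\<lambda>t. C * indicator {0..T} t + e / 2 * (indicator {0..} t * exp (- x * t)))"
        by (intro Bochner_Integration.integrable_add integrable_mult_right integrable_exp_decay that) (auto simp: integrable_indicator_iff emeasure_lborel_Icc_eq)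
      show "indicator {0..} t *\<^sub>R (norm (h t) * exp (- x * t))
          \<le> C * indicator {0..T} t + e / 2 * (indicator {0..} t * exp (- x * t))" for t
      proof (cases "t \<ge> 0")
        case t: True
        show ?thesis
        proof (cases "t \<le> T")
          case True
          have "norm (h t) * exp (- x * t) \<le> C * 1"
            using t that C assms(2)[of t] by (intro mult_mono) auto
          moreover have "0 \<le> e / 2 * exp (- x * t)" using \<open>e > 0\<close> by simp
          ultimately show ?thesis using t True by simp
        next
          case False
          then show ?thesis using t T(2)[of t] by (simp add: mult_right_mono)
        qed
      qed auto
    qed
    also have "\<dots> = C * T + e / 2 * (1 / x)"
    proof (rule has_bochner_integral_integral_eq)
      have "has_bochner_integral lborel (\<lambda>t. indicator {0..T} t :: real) T"
        using T(1) by (simp add: has_bochner_integral_iff)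
      then show "has_bochner_integral lborel
          (\<lambda>t. C * indicator {0..T} t + e / 2 * (indicator {0..} t * exp (- x * t))) (C * T + e / 2 * (1 / x))"
        by (intro has_bochner_integral_add has_bochner_integral_mult_right has_bochner_integral_exp_decay that)
    qed
    finally have "x * (LINT t:{0..}|lborel. norm (h t) * exp (- x * t)) \<le> x * (C * T + e / 2 * (1 / x))"
      using that by (intro mult_left_mono) auto
    then show ?thesis using that by (simp add: algebra_simps)
  qed
  have "((\<lambda>x. x * (C * T) + e / 2) \<longlongrightarrow> 0 * (C * T) + e / 2) (at_right 0)"
    by (intro tendsto_intros)
  then have "\<forall>\<^sub>F x in at_right 0. x * (C * T) + e / 2 < e"
    by (rule order_tendstoD) (use \<open>e > 0\<close> in simp)
  moreover have "\<forall>\<^sub>F x in at_right (0::real). x > 0" by (rule eventually_at_right_less)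
  ultimately show "\<forall>\<^sub>F x in at_right 0. dist (x * (LINT t:{0..}|lborel. norm (h t) * exp (- x * t))) 0 < e"
  proof eventually_elim
    case (elim x)
    have "0 \<le> (LINT t:{0..}|lborel. norm (h t) * exp (- x * t))"
      unfolding set_lebesgue_integral_def by (rule integral_nonneg_AE) auto
    then show ?case using le[of x] elim by simp
  qed
qed

text \<open>Lerch's theorem. With s = exp (- t), zeros of the transform at the points x + n say that
  all moments of u (- ln s) against the weight s^(x - 1) on [0, 1] vanish; by Weierstrass the
  integral of u^2 exp (- x t) is then 0.\<close>

lemma laplace_real_unique:
  fixes u :: "real \<Rightarrow> real"
  assumes cont: "continuous_on UNIV u" and lim: "(u \<longlongrightarrow> 0) at_top" and "x > 0"
    and int: "set_integrable lborel {0..} (\<lambda>t. u t * exp (- x * t))"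
    and zero: "\<And>n. (LINT t:{0..}|lborel. u t * exp (- (x + real n) * t)) = 0"
    and "t \<ge> 0"
  shows "u t = 0"
proof -
  \<comment> \<open>This is \<open>u\<close> after the substitution s = exp (- t), which maps the
    half line onto (0, 1]. Since \<open>u\<close> tends to 0 at infinity, the value 0 at s = 0 makes
    \<open>K\<close> continuous on [0, 1].\<close>
  define K where "K = (\<lambda>s. if s \<le> 0 then 0 else u (- ln s))"
  have [measurable]: "u \<in> borel_measurable borel"
    using cont by (rule borel_measurable_continuous_onI)
  have contK: "continuous_on {0..1} K"
    unfolding continuous_on_eq_continuous_within
  proof
    fix s :: real assume s: "s \<in> {0..1}"
    show "continuous (at s within {0..1}) K"
    proof (cases "s = 0")
      case True
      have "filterlim (\<lambda>s. - ln s) at_top (at_right (0::real))"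
        using ln_at_0 by (simp add: filterlim_uminus_at_top)
      then have "((\<lambda>s. u (- ln s)) \<longlongrightarrow> 0) (at_right 0)"
        using lim by (rule filterlim_compose[rotated])
      moreover have "\<forall>\<^sub>F s in at_right 0. u (- ln s) = K s"
        using eventually_at_right_less[of 0] by eventually_elim (auto simp: K_def)
      ultimately have "(K \<longlongrightarrow> 0) (at_right 0)"
        by (rule Lim_transform_eventually)
      moreover have "at (0::real) within {0..1} = at_right 0"
        by (simp add: at_within_Icc_at_right)
      ultimately show ?thesis
        using True by (simp add: continuous_within K_def)
    next
      case False
      with s have "s > 0" by auto
      have "isCont (\<lambda>s. u (- ln s)) s"
        by (rule isCont_o2) (use cont \<open>s > 0\<close> in \<open>auto simp: continuous_on_eq_continuous_at intro!: continuous_intros\<close>)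
      moreover have "\<forall>\<^sub>F r in nhds s. u (- ln r) = K r"
        using eventually_nhds_in_open[of "{0<..}" s] \<open>s > 0\<close> by (auto simp: K_def elim!: eventually_mono)
      ultimately have "isCont K s"
        by (simp add: isCont_cong)
      then show ?thesis by (rule continuous_at_imp_continuous_at_within)
    qed
  qed
  have ind: "indicator {0..} t *\<^sub>R ((\<Sum>i\<le>n. a i * exp (- t) ^ i) * (u t * exp (- x * t)))
      = (\<Sum>i\<le>n. a i * (indicator {0..} t *\<^sub>R (u t * exp (- (x + real i) * t))))" for t n and a :: "nat \<Rightarrow> real"
  proof -
    have "exp (- t) ^ i * exp (- x * t) = exp (- (x + real i) * t)" for i
      by (simp add: exp_of_nat_mult[symmetric] exp_add[symmetric] algebra_simps)
    then have e: "a i * exp (- t) ^ i * (u t * exp (- x * t)) = a i * (u t * exp (- (x + real i) * t))" for i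
      by (metis (no_types, opaque_lifting) mult.assoc mult.left_commute)
    then show ?thesis
      by (simp only: sum_distrib_right e scaleR_sum_right mult_scaleR_right)
  qed
  have inti: "integrable lborel (\<lambda>t. indicator {0..} t *\<^sub>R (u t * exp (- (x + real i) * t)))" for i
  proof (rule Bochner_Integration.integrable_bound[OF int[unfolded set_integrable_def]])
    show "AE t in lborel. norm (indicator {0..} t *\<^sub>R (u t * exp (- (x + real i) * t)))
        \<le> norm (indicator {0..} t *\<^sub>R (u t * exp (- x * t)))"
      by (intro AE_I2) (auto simp: indicator_def abs_mult algebra_simps intro!: mult_left_mono)
  qed simp
  define W where "W = (LINT t:{0..}|lborel. \<bar>u t\<bar> * exp (- x * t))"
  \<comment> \<open>The bound on \<open>u\<close> is needed for the integrability of u^2 exp (- x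
    t).\<close>
  obtain D where D: "\<And>t. t \<ge> 0 \<Longrightarrow> \<bar>u t\<bar> \<le> D"
  proof -
    have "compact (K ` {0..1})" using contK by (intro compact_continuous_image) auto
    then obtain D where D: "\<And>s. s \<in> {0..1} \<Longrightarrow> \<bar>K s\<bar> \<le> D"
      using compact_imp_bounded bounded_iff by (metis image_eqI real_norm_def)
    have "\<bar>u t\<bar> \<le> D" if "t \<ge> 0" for t
      using D[of "exp (- t)"] that by (auto simp: K_def)
    then show ?thesis using that by blast
  qed
  have int2: "integrable lborel (\<lambda>t. indicator {0..} t *\<^sub>R (u t * (u t * exp (- x * t))))"
  proof (rule Bochner_Integration.integrable_bound)
    show "integrable lborel (\<lambda>t. D * (indicator {0..} t *\<^sub>R (u t * exp (- x * t))))"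
      using int by (intro integrable_mult_right) (simp add: set_integrable_def)
    show "AE t in lborel. norm (indicator {0..} t *\<^sub>R (u t * (u t * exp (- x * t))))
        \<le> norm (D * (indicator {0..} t *\<^sub>R (u t * exp (- x * t))))"
    proof (intro AE_I2)
      fix t
      show "norm (indicator {0..} t *\<^sub>R (u t * (u t * exp (- x * t))))
        \<le> norm (D * (indicator {0..} t *\<^sub>R (u t * exp (- x * t))))"
        using D[of t] by (auto simp: indicator_def abs_mult intro!: mult_right_mono)
    qed
  qed simp
  \<comment> \<open>By \<open>zero\<close>, polynomials in exp (- t) are orthogonal to
    \<open>u\<close> for the weight exp (- x t). Subtracting from one factor \<open>u\<close> a
    polynomial within \<open>e\<close> of it leaves at most \<open>e * W\<close>.\<close>
  have small: "(LINT t:{0..}|lborel. u t * (u t * exp (- x * t))) \<le> e * W" if "e > 0" for e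
  proof -
    obtain q where "real_polynomial_function q" and q: "\<And>s. s \<in> {0..1} \<Longrightarrow> \<bar>K s - q s\<bar> < e"
      using Stone_Weierstrass_real_polynomial_function[OF compact_Icc contK \<open>e > 0\<close>] by blast
    then obtain a n where qa: "q = (\<lambda>s. \<Sum>i\<le>n. a i * s ^ i)"
      by (auto simp: real_polynomial_function_iff_sum)
    have q0: "has_bochner_integral lborel (\<lambda>t. indicator {0..} t *\<^sub>R (q (exp (- t)) * (u t * exp (- x * t)))) 0"
    proof -
      have "has_bochner_integral lborel (\<lambda>t. \<Sum>i\<le>n. a i * (indicator {0..} t *\<^sub>R (u t * exp (- (x + real i) * t)))) (\<Sum>i\<le>n. a i * 0)"
        using inti zero
        by (intro has_bochner_integral_sum has_bochner_integral_mult_right)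
           (simp add: has_bochner_integral_iff set_lebesgue_integral_def)
      then show ?thesis unfolding qa ind by simp
    qed
    have "(LINT t:{0..}|lborel. u t * (u t * exp (- x * t)))
        = (LINT t|lborel. indicator {0..} t *\<^sub>R (u t * (u t * exp (- x * t))) - indicator {0..} t *\<^sub>R (q (exp (- t)) * (u t * exp (- x * t))))"
      using q0 int2 by (subst Bochner_Integration.integral_diff) (auto simp: has_bochner_integral_iff set_lebesgue_integral_def)
    also have "\<dots> \<le> (LINT t|lborel. e * (indicator {0..} t *\<^sub>R (\<bar>u t\<bar> * exp (- x * t))))"
    proof (rule integral_mono)
      show "integrable lborel (\<lambda>t. indicator {0..} t *\<^sub>R (u t * (u t * exp (- x * t))) - indicator {0..} t *\<^sub>R (q (exp (- t)) * (u t * exp (- x * t))))"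
        using q0 int2 by (intro Bochner_Integration.integrable_diff) (auto simp: has_bochner_integral_iff)
      show "integrable lborel (\<lambda>t. e * (indicator {0..} t *\<^sub>R (\<bar>u t\<bar> * exp (- x * t))))"
        using set_integrable_norm[OF int] by (intro integrable_mult_right) (simp add: set_integrable_def abs_mult)
      show "indicator {0..} t *\<^sub>R (u t * (u t * exp (- x * t))) - indicator {0..} t *\<^sub>R (q (exp (- t)) * (u t * exp (- x * t)))
          \<le> e * (indicator {0..} t *\<^sub>R (\<bar>u t\<bar> * exp (- x * t)))" for t
      proof (cases "t \<ge> 0")
        case True
        have "\<bar>u t - q (exp (- t))\<bar> \<le> e"
          using q[of "exp (- t)"] True by (auto simp: K_def)
        then have "\<bar>(u t - q (exp (- t))) * u t\<bar> \<le> e * \<bar>u t\<bar>"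
          by (simp add: abs_mult mult_right_mono)
        then have "(u t - q (exp (- t))) * u t * exp (- x * t) \<le> e * \<bar>u t\<bar> * exp (- x * t)"
          by (intro mult_right_mono) auto
        then show ?thesis using True by (simp add: algebra_simps)
      qed auto
    qed
    also have "\<dots> = e * W"
      by (simp add: W_def set_lebesgue_integral_def)
    finally show ?thesis .
  qed
  have "((\<lambda>e. e * W) \<longlongrightarrow> 0 * W) (at_right 0)"
    by (intro tendsto_intros)
  moreover have "\<forall>\<^sub>F e in at_right 0. (LINT t:{0..}|lborel. u t * (u t * exp (- x * t))) \<le> e * W"
    using eventually_at_right_less[of 0] by eventually_elim (rule small)
  ultimately have le: "(LINT t:{0..}|lborel. u t * (u t * exp (- x * t))) \<le> 0 * W"
    by (rule tendsto_lowerbound) auto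
  have nonneg: "0 \<le> indicator {0..} t *\<^sub>R (u t * (u t * exp (- x * t)))" for t
    by (auto simp: indicator_def mult.assoc[symmetric] zero_le_mult_iff)
  have "(LINT t|lborel. indicator {0..} t *\<^sub>R (u t * (u t * exp (- x * t)))) = 0"
    using le[unfolded set_lebesgue_integral_def mult_zero_left] Bochner_Integration.integral_nonneg[OF nonneg]
    by (rule antisym)
  then have "AE t in lborel. indicator {0..} t *\<^sub>R (u t * (u t * exp (- x * t))) = 0"
    using integral_nonneg_eq_0_iff_AE[OF int2] nonneg by simp
  then have "AE t in lborel. t \<in> {0<..} \<longrightarrow> u t = 0"
    by eventually_elim auto
  then have pos: "u t = 0" if "t > 0" for t
    using AE_zero_continuous_imp_zero[of "{0<..}" u t] continuous_on_subset[OF cont] that by simp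
  \<comment> \<open>The almost-everywhere argument covers the open half line; the end point is
    reached by continuity.\<close>
  have "(u \<longlongrightarrow> u 0) (at_right 0)"
    using cont by (auto simp: continuous_on_eq_continuous_at isCont_def intro: filterlim_at_split[THEN iffD1, THEN conjunct2])
  moreover have "(u \<longlongrightarrow> 0) (at_right 0)"
    using eventually_at_right_less[of 0] by (intro tendsto_eventually, eventually_elim) (rule pos)
  ultimately have "u 0 = 0"
    by (rule tendsto_unique[rotated]) simp
  then show ?thesis using pos \<open>t \<ge> 0\<close> by (cases "t = 0") auto
qed

text \<open>The difference of indicators encodes the oriented integral from 0 to \<open>a\<close>:
  it is 1 on [0, a) for a \<ge> 0 and -1 on [a, 0) for a < 0. Shifts of both signs thus share one
  formula.\<close>

definition laplace_segment :: "(real \<Rightarrow> complex) \<Rightarrow> real \<Rightarrow> complex \<Rightarrow> complex" where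
  "laplace_segment h a z =
     (LINT s|lborel. (indicator {0..} s - indicator {a..} s) *\<^sub>R (h s * exp (- z * of_real s)))"

text \<open>Up to the segment term, translation multiplies the transform by an exponential. A
  relation between translates thereby becomes an equation Q * transform = P between functions of
  \<open>z\<close>.\<close>

lemma laplace_shift:
  fixes h :: "real \<Rightarrow> complex"
  assumes [measurable]: "h \<in> borel_measurable borel" and "\<And>t. norm (h t) \<le> C" and "Re z > 0"
  shows "laplace (\<lambda>s. h (s + a)) z = exp (z * of_real a) * (laplace h z - laplace_segment h a z)"
proof -
  have int: "integrable lborel (\<lambda>s. indicator {b..} s *\<^sub>R (h s * exp (- z * of_real s)))" for b
    using set_integrable_laplace[OF assms] by (simp add: set_integrable_def)
  have "laplace h z - laplace_segment h a z = (LINT s|lborel. indicator {a..} s *\<^sub>R (h s * exp (- z * of_real s)))"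
    using int by (simp add: laplace_def laplace_segment_def set_lebesgue_integral_def scaleR_diff_left)
  also have "\<dots> = (LINT s|lborel. indicator {a..} (a + 1 * s) *\<^sub>R (h (a + 1 * s) * exp (- z * of_real (a + 1 * s))))"
    by (subst lborel_integral_real_affine[of 1 _ a]) auto
  also have "\<dots> = (LINT s|lborel. exp (- z * of_real a) * (indicator {0..} s *\<^sub>R (h (s + a) * exp (- z * of_real s))))"
    by (intro Bochner_Integration.integral_cong) (auto simp: indicator_def add.commute exp_diff exp_minus field_simps)
  also have "\<dots> = exp (- z * of_real a) * laplace (\<lambda>s. h (s + a)) z"
    unfolding laplace_def set_lebesgue_integral_def by (rule integral_mult_right_zero)
  finally show ?thesis
    by (simp add: exp_minus field_simps)
qed

text \<open>This makes the relation for the reflected function, taken at \<open>- z\<close>, have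
  the same right-hand side up to sign, so both half lines lead to one quotient.\<close>

lemma laplace_segment_reflect:
  fixes h :: "real \<Rightarrow> complex"
  assumes [measurable]: "h \<in> borel_measurable borel"
  shows "laplace_segment (\<lambda>s. h (- s)) (- a) (- z) = - laplace_segment h a z"
proof -
  have "laplace_segment (\<lambda>s. h (- s)) (- a) (- z)
      = (LINT s|lborel. (indicator {0..} (0 + (-1) * s) - indicator {- a..} (0 + (-1) * s)) *\<^sub>R
           (h (- (0 + (-1) * s)) * exp (- (- z) * of_real (0 + (-1) * s))))"
    unfolding laplace_segment_def by (subst lborel_integral_real_affine[of "-1" _ 0]) auto
  \<comment> \<open>Reflection turns half lines closed on the left into half lines closed on the
    right, so the integrands may differ at the points 0 and \<open>a\<close>.\<close>
  also have "\<dots> = (LINT s|lborel. - ((indicator {0..} s - indicator {a..} s) *\<^sub>R (h s * exp (- z * of_real s))))"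
  proof (rule integral_cong_AE)
    show "AE s in lborel. (indicator {0..} (0 + (-1) * s) - indicator {- a..} (0 + (-1) * s)) *\<^sub>R
           (h (- (0 + (-1) * s)) * exp (- (- z) * of_real (0 + (-1) * s)))
         = - ((indicator {0..} s - indicator {a..} s) *\<^sub>R (h s * exp (- z * of_real s)))"
      using AE_lborel_singleton[of 0] AE_lborel_singleton[of a]
      by eventually_elim (auto simp: indicator_def)
  qed measurable
  finally show ?thesis
    by (simp add: laplace_segment_def)
qed

lemma holomorphic_laplace_segment:
  fixes h :: "real \<Rightarrow> complex"
  assumes "continuous_on UNIV h" "a \<ge> 0"
  shows "laplace_segment h a holomorphic_on UNIV"
proof -
  have [measurable]: "h \<in> borel_measurable borel"
    using assms(1) by (rule borel_measurable_continuous_onI)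
  have cont: "continuous_on {0..a} h"
    using assms(1) continuous_on_subset by blast
  have "laplace_segment h a z = integral (cbox 0 a) (\<lambda>s. h s * exp (- z * of_real s))" for z
  proof -
    have "laplace_segment h a z = (LINT s:{0..a}|lborel. h s * exp (- z * of_real s))"
      unfolding laplace_segment_def set_lebesgue_integral_def
    proof (rule integral_cong_AE)
      show "AE s in lborel. (indicator {0..} s - indicator {a..} s) *\<^sub>R (h s * exp (- z * of_real s))
          = indicator {0..a} s *\<^sub>R (h s * exp (- z * of_real s))"
        using AE_lborel_singleton[of a] by eventually_elim (use assms(2) in \<open>auto simp: indicator_def\<close>)
    qed measurable
    also have "\<dots> = integral {0..a} (\<lambda>s. h s * exp (- z * of_real s))"
      by (intro set_borel_integral_eq_integral borel_integrable_atLeastAtMost' continuous_intros cont)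
    finally show ?thesis by simp
  qed
  moreover have "(\<lambda>z. integral (cbox 0 a) (\<lambda>s. h s * exp (- z * of_real s))) holomorphic_on UNIV"
  proof (rule leibniz_rule_holomorphic)
    show "((\<lambda>z. h s * exp (- z * of_real s)) has_field_derivative h s * (- of_real s * exp (- z * of_real s))) (at z within UNIV)" for z s
      by (auto intro!: derivative_eq_intros)
    show "(\<lambda>s. h s * exp (- z * of_real s)) integrable_on cbox 0 a" for z
      by (auto intro!: integrable_continuous_interval continuous_intros cont)
    show "continuous_on (UNIV \<times> cbox 0 a) (\<lambda>(z, s). h s * (- of_real s * exp (- z * of_real s)))"
      unfolding case_prod_unfold
      by (intro continuous_intros continuous_on_compose2[OF assms(1)]) auto
  qed auto
  ultimately show ?thesis by presburger
qed

section \<open>Linear relations between translates\<close>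

lemma eventually_exp_sum_nonzero:
  fixes t :: "'i \<Rightarrow> real" and c :: "'i \<Rightarrow> complex"
  assumes "finite I" "inj_on t I" "\<exists>k\<in>I. c k \<noteq> 0"
  shows "\<forall>\<^sub>F x in at_top. (\<Sum>k\<in>I. c k * exp (of_real x * of_real (t k))) \<noteq> 0"
proof -
  define I' where "I' = {k\<in>I. c k \<noteq> 0}"
  have I': "finite I'" "I' \<noteq> {}" using assms by (auto simp: I'_def)
  \<comment> \<open>Among the terms with nonzero coefficient \<open>T\<close> is the largest
    exponent, attained only once as \<open>t\<close> is injective. Divided by exp (x T), the sum
    tends to the coefficient of that term.\<close>
  define T where "T = Max (t ` I')"
  have "T \<in> t ` I'" unfolding T_def using I' by (intro Max_in) auto
  then obtain j where j: "j \<in> I'" "t j = T" by auto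
  have lim: "((\<lambda>x. c k * of_real (exp (x * (t k - T)))) \<longlongrightarrow> (if k = j then c j else 0)) at_top" if "k \<in> I'" for k
  proof (cases "k = j")
    case True
    then show ?thesis using j by simp
  next
    case False
    have "t k \<noteq> T" using False j that assms(2) by (auto simp: I'_def dest: inj_onD)
    moreover have "t k \<le> T" unfolding T_def using I' that by auto
    ultimately have "t k - T < 0" by simp
    then have "((\<lambda>x. exp (x * (t k - T))) \<longlongrightarrow> 0) at_top"
      by real_asymp
    then show ?thesis
      using False by (auto intro!: tendsto_mult_right_zero tendsto_of_real_iff[THEN iffD2, of _ 0, simplified])
  qed
  have "((\<lambda>x. \<Sum>k\<in>I'. c k * of_real (exp (x * (t k - T)))) \<longlongrightarrow> (\<Sum>k\<in>I'. if k = j then c j else 0)) at_top"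
    by (intro tendsto_sum lim)
  also have "(\<Sum>k\<in>I'. if k = j then c j else 0) = c j"
    using I' j by simp
  finally have "\<forall>\<^sub>F x in at_top. (\<Sum>k\<in>I'. c k * of_real (exp (x * (t k - T)))) \<noteq> 0"
    using j by (intro tendsto_imp_eventually_ne) (auto simp: I'_def)
  then show ?thesis
  proof eventually_elim
    case (elim x)
    have "(\<Sum>k\<in>I. c k * exp (of_real x * of_real (t k))) = (\<Sum>k\<in>I'. c k * exp (of_real x * of_real (t k)))"
      unfolding I'_def using assms(1) by (intro sum.mono_neutral_right) auto
    also have "\<dots> = (\<Sum>k\<in>I'. of_real (exp (x * T)) * (c k * of_real (exp (x * (t k - T)))))"
    proof (intro sum.cong refl)
      fix k
      have "exp (of_real x * of_real (t k)) = complex_of_real (exp (x * T) * exp (x * (t k - T)))"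
        by (simp add: exp_add[symmetric] exp_of_real[symmetric] algebra_simps)
      then show "c k * exp (of_real x * of_real (t k)) = of_real (exp (x * T)) * (c k * of_real (exp (x * (t k - T))))"
        by simp
    qed
    also have "\<dots> = of_real (exp (x * T)) * (\<Sum>k\<in>I'. c k * of_real (exp (x * (t k - T))))"
      by (simp add: sum_distrib_left)
    finally show ?case using elim by simp
  qed
qed

text \<open>At a real argument the kernel is real, so Re and Im pass through the transform and
  reduce the claim to \<open>laplace_real_unique\<close> at the points X + n.\<close>

lemma laplace_unique:
  fixes h :: "real \<Rightarrow> complex"
  assumes cont: "continuous_on UNIV h" and bound: "\<And>s. norm (h s) \<le> C" and lim: "(h \<longlongrightarrow> 0) at_top"
    and "X > 0" and zero: "\<And>x. x \<ge> X \<Longrightarrow> laplace h (of_real x) = 0" and "s \<ge> 0"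
  shows "h s = 0"
proof -
  have [measurable]: "h \<in> borel_measurable borel"
    using cont by (rule borel_measurable_continuous_onI)
  have int: "integrable lborel (\<lambda>s. indicator {0..} s *\<^sub>R (h s * exp (- of_real x * of_real s)))" if "x \<ge> X" for x
    using set_integrable_laplace[of h C "of_real x" 0] bound that \<open>X > 0\<close> by (simp add: set_integrable_def)
  have part: "f (h s) = 0" if f: "bounded_linear f" and fm: "\<And>z r. f (z * of_real r) = f z * r" for f :: "complex \<Rightarrow> real"
  proof (rule laplace_real_unique[where u = "\<lambda>s. f (h s)" and x = X])
    interpret f: bounded_linear f by (rule f)
    have eq: "indicator {0..} s *\<^sub>R (f (h s) * exp (- x * s)) = f (indicator {0..} s *\<^sub>R (h s * exp (- of_real x * of_real s)))" for x s :: real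
    proof -
      have "h s * exp (- of_real x * of_real s) = h s * of_real (exp (- x * s))"
        by (simp add: exp_of_real[symmetric])
      then show ?thesis by (simp only: f.scaleR fm real_scaleR_def)
    qed
    show "continuous_on UNIV (\<lambda>s. f (h s))"
      by (intro f.continuous_on cont)
    show "((\<lambda>s. f (h s)) \<longlongrightarrow> 0) at_top"
      using f.tendsto[OF lim] by (simp add: f.zero)
    show "set_integrable lborel {0..} (\<lambda>s. f (h s) * exp (- X * s))"
      unfolding set_integrable_def eq by (rule integrable_bounded_linear[OF f int]) simp
    show "(LINT s:{0..}|lborel. f (h s) * exp (- (X + real n) * s)) = 0" for n
      unfolding set_lebesgue_integral_def eq
      using integral_bounded_linear[OF f int, of "X + real n"] zero[of "X + real n"]
      by (simp add: laplace_def set_lebesgue_integral_def f.zero)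
  qed (use assms in auto)
  show ?thesis
    using part[OF bounded_linear_Re] part[OF bounded_linear_Im] by (simp add: complex_eq_iff)
qed

text \<open>Nonnegative shifts make every segment an integral over [0, t k], which is entire in
  \<open>z\<close>. Decay at the right end yields \<open>B\<close> on the right half plane; on the
  left half plane boundedness serves. The conclusion stops at 0 because the transform sees only the
  half line.\<close>

lemma translates_independent_half_line:
  fixes h :: "real \<Rightarrow> complex" and t :: "'i \<Rightarrow> real" and c :: "'i \<Rightarrow> complex"
  assumes I: "finite I" "inj_on t I" "\<exists>k\<in>I. c k \<noteq> 0" "\<And>k. k \<in> I \<Longrightarrow> t k \<ge> 0"
    and cont: "continuous_on UNIV h" and bound: "\<And>s. norm (h s) \<le> C"
    and lim: "(h \<longlongrightarrow> 0) at_top"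
    and eq: "\<And>x. (\<Sum>k\<in>I. c k * h (x + t k)) = 0" and "s \<ge> 0"
  shows "h s = 0"
proof -
  have C: "C \<ge> 0" using bound[of 0] norm_ge_zero order_trans by blast
  have [measurable]: "h \<in> borel_measurable borel"
    using cont by (rule borel_measurable_continuous_onI)
  define Q where "Q = (\<lambda>z. \<Sum>k\<in>I. c k * exp (z * of_real (t k)))"
  define P where "P = (\<lambda>z. \<Sum>k\<in>I. c k * exp (z * of_real (t k)) * laplace_segment h (t k) z)"
  \<comment> \<open>The function and the shifts are kept general, for use both with \<open>h\<close>
    and \<open>t\<close> and with the reflection of \<open>h\<close> and the shifts
    \<open>- t k\<close>.\<close>
  have QP: "(\<Sum>k\<in>I. c k * exp (z * of_real (d k))) * laplace g z
      = (\<Sum>k\<in>I. c k * exp (z * of_real (d k)) * laplace_segment g (d k) z)"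
    if [measurable]: "g \<in> borel_measurable borel" and g: "\<And>s. norm (g s) \<le> C"
      "\<And>x. (\<Sum>k\<in>I. c k * g (x + d k)) = 0" and z: "Re z > 0" for g d z
  proof -
    have "0 = laplace (\<lambda>x. \<Sum>k\<in>I. c k * g (x + d k)) z"
      by (simp add: laplace_def g(2))
    also have "\<dots> = (LINT x|lborel. (\<Sum>k\<in>I. c k * (indicator {0..} x *\<^sub>R (g (x + d k) * exp (- z * of_real x)))))"
      unfolding laplace_def set_lebesgue_integral_def
      by (intro Bochner_Integration.integral_cong) (simp_all add: sum_distrib_right scaleR_sum_right mult.assoc)
    also have "\<dots> = (\<Sum>k\<in>I. c k * laplace (\<lambda>x. g (x + d k)) z)"
    proof (subst Bochner_Integration.integral_sum)
      show "integrable lborel (\<lambda>x. c k * (indicator {0..} x *\<^sub>R (g (x + d k) * exp (- z * of_real x))))" for k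
        using set_integrable_laplace[of "\<lambda>x. g (x + d k)" C z 0] g z
        by (intro integrable_mult_right) (simp add: set_integrable_def)
    qed (simp only: laplace_def set_lebesgue_integral_def integral_mult_right_zero)
    also have "\<dots> = (\<Sum>k\<in>I. c k * (exp (z * of_real (d k)) * (laplace g z - laplace_segment g (d k) z)))"
      using g z by (intro sum.cong refl arg_cong2[where f = "(*)"] laplace_shift) auto
    finally show ?thesis
      by (simp add: sum_distrib_left sum_distrib_right sum_subtractf algebra_simps)
  qed
  have pos: "P z = Q z * laplace h z" if "Re z > 0" for z
    unfolding P_def Q_def using QP[of h t z] bound eq that by simp
  have neg: "P z = - (Q z * laplace (\<lambda>s. h (- s)) (- z))" if "Re z < 0" for z
  proof -
    have "(\<Sum>k\<in>I. c k * h (- (x + - t k))) = 0" for x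
      using eq[of "- x"] by simp
    then show ?thesis
      unfolding P_def Q_def
      using QP[of "\<lambda>s. h (- s)" "\<lambda>k. - t k" "- z"] bound that
      by (simp add: laplace_segment_reflect sum_negf)
  qed
  have P0: "P z = 0" if "Q z \<noteq> 0" for z
  proof (rule entire_quotient_zero[where P = P and Q = Q and z = z and b = z and C = C
        and B = "\<lambda>x. x * (LINT t:{0..}|lborel. norm (h t) * exp (- x * t))"])
    show "P holomorphic_on UNIV"
      unfolding P_def by (intro holomorphic_intros holomorphic_laplace_segment cont I(4))
    show "Q holomorphic_on UNIV"
      unfolding Q_def by (intro holomorphic_intros)
    show "Q z \<noteq> 0" by fact
    show "Q z \<noteq> 0" by fact
    show "\<bar>Re z\<bar> * norm (P z) \<le> C * norm (Q z)" for z
    proof -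
      consider "Re z > 0" | "Re z < 0" | "Re z = 0" by linarith
      then show ?thesis
      proof cases
        case 1
        have "Re z * norm (laplace h z) \<le> C"
          by (rule order_trans[OF norm_laplace_le(1)[of h C z] norm_laplace_le(2)]) (use bound 1 in auto)
        from mult_right_mono[OF this norm_ge_zero[of "Q z"]] show ?thesis
          using 1 by (simp add: pos norm_mult mult_ac)
      next
        case 2
        have "Re (- z) * norm (laplace (\<lambda>s. h (- s)) (- z)) \<le> C"
          by (rule order_trans[OF norm_laplace_le(1)[of "\<lambda>s. h (- s)" C "- z"] norm_laplace_le(2)])
             (use bound 2 in auto)
        from mult_right_mono[OF this norm_ge_zero[of "Q z"]] show ?thesis
          using 2 by (simp add: neg norm_mult mult_ac)
      qed (use C in auto)
    qed
    show "((\<lambda>x. x * (LINT t:{0..}|lborel. norm (h t) * exp (- x * t))) \<longlongrightarrow> 0) (at_right 0)"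
      using bound lim by (intro laplace_abelian) auto
    show "Re z * norm (P z) \<le> Re z * (LINT t:{0..}|lborel. norm (h t) * exp (- Re z * t)) * norm (Q z)"
      if "Re z > 0" for z
    proof -
      have "Re z * norm (laplace h z) \<le> Re z * (LINT t:{0..}|lborel. norm (h t) * exp (- Re z * t))"
        using norm_laplace_le(1)[of h C z] bound that by simp
      from mult_right_mono[OF this norm_ge_zero[of "Q z"]] show ?thesis
        using that by (simp add: pos norm_mult mult_ac)
    qed
  qed
  \<comment> \<open>Far out on the real axis \<open>Q\<close> has no zeros, so P = 0 there makes the
    transform itself vanish, as \<open>laplace_unique\<close> requires.\<close>
  have "\<forall>\<^sub>F x in at_top. Q (of_real x) \<noteq> 0"
    unfolding Q_def by (rule eventually_exp_sum_nonzero[OF I(1-3)])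
  then obtain X where X: "\<And>x. x \<ge> X \<Longrightarrow> Q (of_real x) \<noteq> 0"
    by (auto simp: eventually_at_top_linorder)
  show ?thesis
  proof (rule laplace_unique[OF cont bound lim])
    show "laplace h (of_real x) = 0" if "x \<ge> max X 1" for x
      using pos[of "of_real x"] P0[of "of_real x"] X[of x] that by auto
  qed (use \<open>s \<ge> 0\<close> in auto)
qed

text \<open>The relation survives a translation of \<open>h\<close> and the addition of one constant
  to all shifts. The latter makes the shifts nonnegative, the former brings an arbitrary point
  \<open>s\<close> to 0.\<close>

lemma translates_independent_bounded:
  fixes h :: "real \<Rightarrow> complex" and t :: "'i \<Rightarrow> real" and c :: "'i \<Rightarrow> complex"
  assumes I: "finite I" "inj_on t I" "\<exists>k\<in>I. c k \<noteq> 0"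
    and cont: "continuous_on UNIV h" and bound: "\<And>s. norm (h s) \<le> C"
    and lim: "(h \<longlongrightarrow> 0) at_top"
    and eq: "\<And>x. (\<Sum>k\<in>I. c k * h (x + t k)) = 0"
  shows "h s = 0"
proof -
  define b where "b = Min (t ` I)"
  have b: "b \<le> t k" if "k \<in> I" for k
    unfolding b_def using that I(1) by simp
  have "h (0 + s) = 0"
  proof (rule translates_independent_half_line[where h = "\<lambda>x. h (x + s)" and t = "\<lambda>k. t k - b"])
    show "inj_on (\<lambda>k. t k - b) I"
      using I(2) by (auto simp: inj_on_def)
    show "continuous_on UNIV (\<lambda>x. h (x + s))"
      by (intro continuous_on_compose2[OF cont] continuous_intros) auto
    show "((\<lambda>x. h (x + s)) \<longlongrightarrow> 0) at_top"
      by (rule filterlim_compose[OF lim]) real_asymp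
    show "(\<Sum>k\<in>I. c k * h (x + (t k - b) + s)) = 0" for x
      using eq[of "x - b + s"] by (simp add: algebra_simps)
  qed (use assms b in auto)
  then show ?thesis by simp
qed

text \<open>A continuous L^p function can be unbounded, so the bounded case is applied to the
  integrals over [x, x + e], which satisfy the same relation. They vanish for every e > 0, and their
  derivative in \<open>e\<close> at 0 recovers \<open>g x\<close>.\<close>

lemma translates_independent_Lp:
  fixes g :: "real \<Rightarrow> complex" and t :: "'i \<Rightarrow> real" and c :: "'i \<Rightarrow> complex"
  assumes I: "finite I" "inj_on t I" "\<exists>k\<in>I. c k \<noteq> 0"
    and cont: "continuous_on UNIV g" and "1 \<le> p"
    and int: "integrable lborel (\<lambda>s. norm (g s) powr p)"
    and eq: "\<And>x. (\<Sum>k\<in>I. c k * g (x + t k)) = 0"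
  shows "g x = 0"
proof -
  have [measurable]: "g \<in> borel_measurable borel"
    using cont by (rule borel_measurable_continuous_onI)
  have contx [continuous_intros]: "continuous_on S (\<lambda>s. g (x + s))" for S x
    by (intro continuous_on_compose2[OF cont] continuous_intros) auto
  define f where "f = (\<lambda>s. norm (g s) powr p)"
  have contf: "continuous_on S (\<lambda>s. f (x + s))" for S x
    unfolding f_def using \<open>1 \<le> p\<close> by (intro continuous_intros continuous_on_powr') auto
  have f0: "f s \<ge> 0" for s by (simp add: f_def)
  have intf: "integrable lborel f" using int by (simp add: f_def)
  \<comment> \<open>The integral of \<open>f\<close> over a window is an increment of
    \<open>F\<close>; as \<open>F\<close> converges at infinity, the increments tend to 0.\<close>
  define F where "F = (\<lambda>y. LINT s|lborel. indicator {..y} s *\<^sub>R f s)"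
  have F: "integral {0..e} (\<lambda>s. f (x + s)) = F (x + e) - F x" if "e > 0" for e x
  proof -
    have "integral {0..e} (\<lambda>s. f (x + s)) = (LINT s:{0..e}|lborel. f (x + s))"
      by (intro set_borel_integral_eq_integral(2)[symmetric] borel_integrable_atLeastAtMost' contf)
    also have "\<dots> = (LINT s|lborel. indicator {x..x+e} (x + 1 * s) *\<^sub>R f (x + 1 * s))"
      unfolding set_lebesgue_integral_def
      by (intro Bochner_Integration.integral_cong) (auto simp: indicator_def)
    also have "\<dots> = (LINT s|lborel. indicator {x..x+e} s *\<^sub>R f s)"
      by (subst (2) lborel_integral_real_affine[of 1 _ x]) auto
    also have "\<dots> = (LINT s|lborel. indicator {..x+e} s *\<^sub>R f s - indicator {..x} s *\<^sub>R f s)"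
    proof (rule integral_cong_AE)
      show "AE s in lborel. indicator {x..x+e} s *\<^sub>R f s = indicator {..x+e} s *\<^sub>R f s - indicator {..x} s *\<^sub>R f s"
        using AE_lborel_singleton[of x] by eventually_elim (use that in \<open>auto simp: indicator_def\<close>)
    qed (auto simp: f_def)
    also have "\<dots> = F (x + e) - F x"
      unfolding F_def by (intro Bochner_Integration.integral_diff integrable_mult_indicator intf) auto
    finally show ?thesis .
  qed
  have Flim: "(F \<longlongrightarrow> integral\<^sup>L lborel f) at_top"
    unfolding F_def by (rule tendsto_integral_at_top) (auto simp: intf)
  have F01: "0 \<le> F y" "F y \<le> integral\<^sup>L lborel f" for y
    unfolding F_def
    by (intro Bochner_Integration.integral_nonneg integral_mono integrable_mult_indicator intf;
        simp add: indicator_def f0)+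
  have zero: "integral {0..e} (\<lambda>s. g (x + s)) = 0" if "e > 0" for e x
  proof (rule translates_independent_bounded[OF I, where h = "\<lambda>x. integral {0..e} (\<lambda>s. g (x + s))"])
    show "continuous_on UNIV (\<lambda>x. integral {0..e} (\<lambda>s. g (x + s)))"
      using integral_continuous_on_param[of UNIV 0 e "\<lambda>x s. g (x + s)"]
      by (simp add: case_prod_unfold continuous_on_compose2[OF cont] continuous_intros)
    \<comment> \<open>Where |g| exceeds \<open>d\<close>, write |g| = |g|^(1 - p) |g|^p and use 1 -
      p \<le> 0. This stands in for Hoelder's inequality and includes p = 1.\<close>
    have pointwise: "norm (g s) \<le> d + d powr (1 - p) * f s" if "d > 0" for d s
    proof (cases "norm (g s) \<le> d")
      case False
      then have "norm (g s) = norm (g s) powr (1 - p) * f s"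
        unfolding f_def using that by (simp add: powr_add[symmetric])
      also have "\<dots> \<le> d powr (1 - p) * f s"
        using False that \<open>1 \<le> p\<close> f0 by (intro mult_right_mono powr_mono2') auto
      finally show ?thesis using that by simp
    qed (use f0 in \<open>auto intro: add_increasing2\<close>)
    have le: "norm (integral {0..e} (\<lambda>s. g (x + s))) \<le> d * e + d powr (1 - p) * (F (x + e) - F x)" if "d > 0" for d x
    proof -
      have "norm (integral {0..e} (\<lambda>s. g (x + s))) \<le> integral {0..e} (\<lambda>s. d + d powr (1 - p) * f (x + s))"
        by (intro integral_norm_bound_integral integrable_continuous_interval continuous_intros contf pointwise that)
      also have "\<dots> = d * e + d powr (1 - p) * (F (x + e) - F x)"
        using \<open>e > 0\<close> F[OF \<open>e > 0\<close>, of x]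
        by (subst Henstock_Kurzweil_Integration.integral_add)
           (auto intro!: integrable_continuous_interval continuous_intros contf)
      finally show ?thesis .
    qed
    show "norm (integral {0..e} (\<lambda>s. g (x + s))) \<le> e + integral\<^sup>L lborel f" for x
      using le[of 1 x] F01[of "x + e"] F01[of x] by simp
    show "((\<lambda>x. integral {0..e} (\<lambda>s. g (x + s))) \<longlongrightarrow> 0) at_top"
    proof (rule tendstoI)
      fix r :: real assume "r > 0"
      \<comment> \<open>With this choice \<open>d * e\<close> is \<open>r / 2\<close>, and for this
        fixed \<open>d\<close> the other term tends to 0.\<close>
      define d where "d = r / (2 * e)"
      have d: "d > 0" using \<open>r > 0\<close> \<open>e > 0\<close> by (simp add: d_def)
      have "((\<lambda>x. F (x + e)) \<longlongrightarrow> integral\<^sup>L lborel f) at_top"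
        by (rule filterlim_compose[OF Flim]) real_asymp
      then have "((\<lambda>x. d * e + d powr (1 - p) * (F (x + e) - F x)) \<longlongrightarrow>
          d * e + d powr (1 - p) * (integral\<^sup>L lborel f - integral\<^sup>L lborel f)) at_top"
        by (intro tendsto_intros Flim)
      then have "\<forall>\<^sub>F x in at_top. d * e + d powr (1 - p) * (F (x + e) - F x) < r"
        by (rule order_tendstoD) (use \<open>r > 0\<close> \<open>e > 0\<close> in \<open>simp add: d_def\<close>)
      then show "\<forall>\<^sub>F x in at_top. dist (integral {0..e} (\<lambda>s. g (x + s))) 0 < r"
        by eventually_elim (use le[OF d] in \<open>auto intro: le_less_trans\<close>)
    qed
    show "(\<Sum>k\<in>I. c k * integral {0..e} (\<lambda>s. g (x + t k + s))) = 0" for x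
    proof -
      have "(\<Sum>k\<in>I. c k * integral {0..e} (\<lambda>s. g (x + t k + s)))
          = integral {0..e} (\<lambda>s. \<Sum>k\<in>I. c k * g (x + t k + s))"
        by (subst integral_sum) (auto intro!: I integrable_continuous_interval continuous_intros)
      also have "(\<lambda>s. \<Sum>k\<in>I. c k * g (x + t k + s)) = (\<lambda>s. 0)"
        using eq[of "x + _"] by (auto simp: add_ac)
      finally show ?thesis by simp
    qed
  qed
  have "((\<lambda>e. integral {0..e} (\<lambda>s. g (x + s))) has_vector_derivative g (x + 0)) (at 0 within {0..1})"
    by (intro integral_has_vector_derivative continuous_intros) auto
  moreover have "((\<lambda>e. integral {0..e} (\<lambda>s. g (x + s))) has_vector_derivative 0) (at 0 within {0..1})"
  proof (rule has_vector_derivative_transform)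
    show "integral {0..e} (\<lambda>s. g (x + s)) = 0" if "e \<in> {0..1}" for e
      using zero[of e x] that by (cases "e = 0") auto
  qed auto
  ultimately show ?thesis
    using vector_derivative_unique_within_closed_interval[of 0 1 0 "\<lambda>e. integral {0..e} (\<lambda>s. g (x + s))" "g (x + 0)" 0]
    by simp
qed

section \<open>The matrix exponential\<close>

text \<open>The overloaded product of the type is componentwise, so termwise sums and the product
  rule for \<open>**\<close> are drawn from bounded bilinearity.\<close>

lemma bounded_bilinear_matrix_matrix_mult:
  "bounded_bilinear ((**) :: real^'n^'m \<Rightarrow> real^'k^'n \<Rightarrow> real^'k^'m)"
  unfolding bilinear_conv_bounded_bilinear[symmetric] bilinear_def
  by (auto intro!: linearI simp: matrix_matrix_mult_def vec_eq_iff sum.distrib ring_distribs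
      sum_distrib_left mult_ac)

lemma bounded_bilinear_matrix_vector_mult:
  "bounded_bilinear ((*v) :: real^'n^'m \<Rightarrow> real^'n \<Rightarrow> real^'m)"
  unfolding bilinear_conv_bounded_bilinear[symmetric] bilinear_def
  by (auto intro!: linearI simp: matrix_vector_mult_def vec_eq_iff sum.distrib ring_distribs
      sum_distrib_left mult_ac)

lemma matpow_commute: "matpow A k ** A = A ** matpow A k"
  by (induction k) (auto simp: matrix_mul_assoc[symmetric])

lemma matpow_scaleR:
  fixes A :: "real^'n^'n"
  shows "matpow (t *\<^sub>R A) k = t ^ k *\<^sub>R matpow A k"
  by (induction k) (auto simp: matrix_scalar_ac scalar_matrix_assoc[symmetric])

lemma matrix_exp_sums:
  fixes A :: "real^'n^'n"
  shows "(\<lambda>k. (t ^ k / fact k) *\<^sub>R matpow A k) sums matrix_exp (t *\<^sub>R A)"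
proof -
  interpret m: bounded_bilinear "(**) :: real^'n^'n \<Rightarrow> real^'n^'n \<Rightarrow> real^'n^'n"
    by (rule bounded_bilinear_matrix_matrix_mult)
  \<comment> \<open>Left multiplication by \<open>A\<close> enlarges norms by a factor of at most
    \<open>K\<close>, so the series is dominated by a multiple of that of exp (|t| K).\<close>
  obtain K where K: "\<And>B :: real^'n^'n. norm (A ** B) \<le> norm B * K"
    using bounded_linear.bounded[OF m.bounded_linear_right] by blast
  have K0: "K \<ge> 0"
  proof -
    have "0 \<le> norm (mat 1 :: real^'n^'n) * K"
      using K[of "mat 1"] norm_ge_zero order_trans by blast
    moreover have "norm (mat 1 :: real^'n^'n) > 0"
      by (simp add: mat_def vec_eq_iff)
    ultimately show ?thesis by (simp add: zero_le_mult_iff)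
  qed
  have le: "norm (matpow A k) \<le> norm (mat 1 :: real^'n^'n) * K ^ k" for k
  proof (induction k)
    case (Suc k)
    have "norm (matpow A (Suc k)) \<le> norm (matpow A k) * K" using K by simp
    also have "\<dots> \<le> norm (mat 1 :: real^'n^'n) * K ^ k * K"
      using Suc K0 by (intro mult_right_mono)
    finally show ?case by (simp add: mult_ac)
  qed simp
  have "summable (\<lambda>k. (t ^ k / fact k) *\<^sub>R matpow A k)"
  proof (rule summable_comparison_test)
    show "summable (\<lambda>k. norm (mat 1 :: real^'n^'n) * (inverse (fact k) * (\<bar>t\<bar> * K) ^ k))"
      by (intro summable_mult summable_exp)
    show "\<exists>N. \<forall>k\<ge>N. norm ((t ^ k / fact k) *\<^sub>R matpow A k) \<le> norm (mat 1 :: real^'n^'n) * (inverse (fact k) * (\<bar>t\<bar> * K) ^ k)"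
    proof (intro exI allI impI)
      fix k
      have "norm ((t ^ k / fact k) *\<^sub>R matpow A k) = \<bar>t\<bar> ^ k / fact k * norm (matpow A k)"
        by (simp add: power_abs)
      also have "\<dots> \<le> \<bar>t\<bar> ^ k / fact k * (norm (mat 1 :: real^'n^'n) * K ^ k)"
        by (intro mult_left_mono le) auto
      finally show "norm ((t ^ k / fact k) *\<^sub>R matpow A k) \<le> norm (mat 1 :: real^'n^'n) * (inverse (fact k) * (\<bar>t\<bar> * K) ^ k)"
        by (simp add: power_mult_distrib field_simps)
    qed
  qed
  then show ?thesis
    unfolding matrix_exp_def matpow_scaleR scaleR_scaleR by (simp add: sums_iff)
qed

lemma matrix_exp_0: "matrix_exp (0 :: real^'n^'n) = mat 1"
proof -
  have "(\<lambda>k. (0 ^ k / fact k) *\<^sub>R matpow (0 :: real^'n^'n) k) sums matrix_exp (0 *\<^sub>R (0 :: real^'n^'n))"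
    by (rule matrix_exp_sums)
  moreover have "(\<lambda>k. (0 ^ k / fact k) *\<^sub>R matpow (0 :: real^'n^'n) k) sums (\<Sum>k\<in>{0}. (0 ^ k / fact k) *\<^sub>R matpow (0 :: real^'n^'n) k)"
    by (rule sums_finite) auto
  ultimately show ?thesis
    by (auto dest: sums_unique2)
qed

lemma matrix_exp_commute:
  fixes A :: "real^'n^'n"
  shows "matrix_exp (t *\<^sub>R A) ** A = A ** matrix_exp (t *\<^sub>R A)"
proof -
  interpret m: bounded_bilinear "(**) :: real^'n^'n \<Rightarrow> real^'n^'n \<Rightarrow> real^'n^'n"
    by (rule bounded_bilinear_matrix_matrix_mult)
  have "(\<lambda>k. ((t ^ k / fact k) *\<^sub>R matpow A k) ** A) sums (matrix_exp (t *\<^sub>R A) ** A)"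
    by (rule bounded_linear.sums[OF m.bounded_linear_left matrix_exp_sums])
  moreover have "(\<lambda>k. A ** ((t ^ k / fact k) *\<^sub>R matpow A k)) sums (A ** matrix_exp (t *\<^sub>R A))"
    by (rule bounded_linear.sums[OF m.bounded_linear_right matrix_exp_sums])
  ultimately show ?thesis
    by (simp add: m.scaleR_left m.scaleR_right matpow_commute sums_iff)
qed

text \<open>Each component is an everywhere convergent power series in \<open>t\<close> and is
  differentiated termwise; the factor k + 1 in \<open>diffs\<close> cancels against the factorial
  and leaves one more factor \<open>A\<close>.\<close>

lemma has_vector_derivative_matrix_exp:
  fixes A :: "real^'n^'n"
  shows "((\<lambda>t. matrix_exp (t *\<^sub>R A)) has_vector_derivative A ** matrix_exp (t *\<^sub>R A)) (at t)"
  unfolding has_vector_derivative_def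
proof (subst has_derivative_componentwise_within, intro ballI)
  fix i :: "real^'n^'n"
  interpret m: bounded_bilinear "(**) :: real^'n^'n \<Rightarrow> real^'n^'n \<Rightarrow> real^'n^'n"
    by (rule bounded_bilinear_matrix_matrix_mult)
  define c where "c = (\<lambda>k. (matpow A k \<bullet> i) / fact k)"
  have sums: "(\<lambda>k. c k * t ^ k) sums (matrix_exp (t *\<^sub>R A) \<bullet> i)" for t
    using bounded_linear.sums[OF bounded_linear_inner_left[of i] matrix_exp_sums[of t A]]
    by (simp add: c_def mult_ac)
  have "((\<lambda>t. \<Sum>k. c k * t ^ k) has_field_derivative (\<Sum>k. diffs c k * t ^ k)) (at t)"
    using sums by (intro termdiffs_strong_converges_everywhere) (auto simp: sums_iff)
  moreover have "(\<lambda>t. \<Sum>k. c k * t ^ k) = (\<lambda>t. matrix_exp (t *\<^sub>R A) \<bullet> i)"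
    using sums by (auto simp: sums_iff)
  moreover have "(\<Sum>k. diffs c k * t ^ k) = (A ** matrix_exp (t *\<^sub>R A)) \<bullet> i"
  proof -
    have "(\<lambda>k. (A ** ((t ^ k / fact k) *\<^sub>R matpow A k)) \<bullet> i) sums ((A ** matrix_exp (t *\<^sub>R A)) \<bullet> i)"
      by (intro bounded_linear.sums[OF bounded_linear_inner_left] bounded_linear.sums[OF m.bounded_linear_right] matrix_exp_sums)
    also have "(\<lambda>k. (A ** ((t ^ k / fact k) *\<^sub>R matpow A k)) \<bullet> i) = (\<lambda>k. diffs c k * t ^ k)"
      by (simp add: fun_eq_iff diffs_def c_def m.scaleR_right fact_Suc mult_ac del: of_nat_Suc)
    finally show ?thesis by (simp add: sums_iff)
  qed
  ultimately show "((\<lambda>t. matrix_exp (t *\<^sub>R A) \<bullet> i) has_derivative (\<lambda>x. (x *\<^sub>R (A ** matrix_exp (t *\<^sub>R A))) \<bullet> i)) (at t)"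
    by (simp add: has_field_derivative_def mult.commute[of _ "(A ** matrix_exp (t *\<^sub>R A)) \<bullet> i"])
qed

lemma matrix_exp_add:
  fixes A :: "real^'n^'n"
  shows "matrix_exp ((s + t) *\<^sub>R A) = matrix_exp (s *\<^sub>R A) ** matrix_exp (t *\<^sub>R A)"
proof -
  interpret m: bounded_bilinear "(**) :: real^'n^'n \<Rightarrow> real^'n^'n \<Rightarrow> real^'n^'n"
    by (rule bounded_bilinear_matrix_matrix_mult)
  let ?E = "\<lambda>t. matrix_exp (t *\<^sub>R A)"
  \<comment> \<open>For fixed \<open>t\<close> this is constant in \<open>u\<close>, because
    \<open>A\<close> commutes with its exponentials; its value at u = 0 is
    \<open>?E t\<close>.\<close>
  define M where "M = (\<lambda>t u. ?E (- u) ** ?E (u + t))"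
  have D: "(M t has_vector_derivative 0) (at u)" for t u
  proof -
    have "((?E \<circ> (\<lambda>u. u + t)) has_vector_derivative (1 *\<^sub>R (A ** ?E (u + t)))) (at u)"
      by (rule vector_diff_chain_at) (auto intro!: derivative_eq_intros has_vector_derivative_matrix_exp)
    then have 1: "((\<lambda>u. ?E (u + t)) has_vector_derivative (A ** ?E (u + t))) (at u)"
      by (simp add: o_def)
    have 2: "((\<lambda>u. ?E (- u)) has_vector_derivative ((- A) ** ?E (- u))) (at u)"
      using has_vector_derivative_matrix_exp[of "- A" u] by simp
    have "(M t has_vector_derivative (?E (- u) ** (A ** ?E (u + t)) + ((- A) ** ?E (- u)) ** ?E (u + t))) (at u)"
      unfolding M_def by (rule m.has_vector_derivative[OF 2 1])
    moreover have "?E (- u) ** (A ** ?E (u + t)) = (A ** ?E (- u)) ** ?E (u + t)"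
      using matrix_exp_commute[of "- u" A] by (simp add: matrix_mul_assoc)
    ultimately show ?thesis
      by (simp add: m.minus_left)
  qed
  have M: "?E (- u) ** ?E (u + t) = ?E t" for t u
  proof -
    have "M t u = M t 0"
      using has_vector_derivative_zero_constant[of UNIV "M t"] D[THEN has_vector_derivative_at_within]
      by (metis UNIV_I convex_UNIV)
    then show ?thesis by (simp add: M_def matrix_exp_0)
  qed
  have "?E s ** ?E t = ?E s ** (?E (- s) ** ?E (s + t))"
    by (simp only: M)
  \<comment> \<open>Writing s as - (- s) and - s as - s + 0 exhibits the instance u = - s, t = 0 of
    \<open>M\<close>.\<close>
  also have "\<dots> = (?E (- (- s)) ** ?E (- s + 0)) ** ?E (s + t)"
    by (simp add: matrix_mul_assoc)
  also have "\<dots> = ?E (s + t)"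
    by (subst M) (simp add: matrix_exp_0)
  finally show ?thesis by simp
qed

section \<open>Linear images of Lebesgue measure\<close>

lemma nn_integral_lborel_translate:
  fixes a :: "'a::euclidean_space"
  assumes [measurable]: "F \<in> borel_measurable borel"
  shows "(\<integral>\<^sup>+x. F (a + x) \<partial>lborel) = (\<integral>\<^sup>+x. F x \<partial>lborel)"
  by (subst (2) lborel_distr_plus[of a, symmetric]) (simp add: nn_integral_distr)

text \<open>The argument for the uniqueness of Haar measure, applied to the image of Lebesgue measure under \<open>f\<close>.\<close>

lemma nn_integral_linear_image_mult:
  fixes f :: "'a::euclidean_space \<Rightarrow> 'a" and F g :: "'a \<Rightarrow> ennreal"
  assumes f: "linear f" "\<And>x. f (f' x) = x"
    and [measurable]: "F \<in> borel_measurable borel" "g \<in> borel_measurable borel"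
  shows "(\<integral>\<^sup>+x. F (f x) \<partial>lborel) * (\<integral>\<^sup>+x. g x \<partial>lborel)
       = (\<integral>\<^sup>+x. F x \<partial>lborel) * (\<integral>\<^sup>+x. g (- f x) \<partial>lborel)"
proof -
  have [measurable]: "f \<in> borel_measurable borel"
    using f(1) by (intro borel_measurable_continuous_onI linear_continuous_on) (simp add: linear_conv_bounded_linear)
  \<comment> \<open>A translation of the source by \<open>f' y\<close> is a translation of the image
    by \<open>y\<close>; this is how the image measure inherits translation invariance.\<close>
  have add: "f (f' y + x) = y + f x" for x y
    using f by (simp add: linear_add)
  have "(\<integral>\<^sup>+x. F (f x) \<partial>lborel) * (\<integral>\<^sup>+x. g x \<partial>lborel) = (\<integral>\<^sup>+y. (\<integral>\<^sup>+x. F (f x) \<partial>lborel) * g y \<partial>lborel)"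
    by (simp add: nn_integral_cmult)
  also have "\<dots> = (\<integral>\<^sup>+y. (\<integral>\<^sup>+x. F (y + f x) * g y \<partial>lborel) \<partial>lborel)"
  proof (rule nn_integral_cong)
    fix y
    have "(\<integral>\<^sup>+x. F (f x) \<partial>lborel) = (\<integral>\<^sup>+x. F (f (f' y + x)) \<partial>lborel)"
      by (rule nn_integral_lborel_translate[symmetric]) measurable
    then show "(\<integral>\<^sup>+x. F (f x) \<partial>lborel) * g y = (\<integral>\<^sup>+x. F (y + f x) * g y \<partial>lborel)"
      by (simp add: add nn_integral_multc)
  qed
  also have "\<dots> = (\<integral>\<^sup>+x. (\<integral>\<^sup>+y. F (y + f x) * g y \<partial>lborel) \<partial>lborel)"
    by (rule lborel_pair.Fubini') measurable
  also have "\<dots> = (\<integral>\<^sup>+x. (\<integral>\<^sup>+y. F y * g (y - f x) \<partial>lborel) \<partial>lborel)"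
  proof (rule nn_integral_cong)
    fix x
    show "(\<integral>\<^sup>+y. F (y + f x) * g y \<partial>lborel) = (\<integral>\<^sup>+y. F y * g (y - f x) \<partial>lborel)"
      using nn_integral_lborel_translate[of "\<lambda>y. F y * g (y - f x)" "f x"] by (simp add: add.commute)
  qed
  also have "\<dots> = (\<integral>\<^sup>+y. (\<integral>\<^sup>+x. F y * g (y - f x) \<partial>lborel) \<partial>lborel)"
    by (rule lborel_pair.Fubini') measurable
  also have "\<dots> = (\<integral>\<^sup>+y. F y * (\<integral>\<^sup>+x. g (- f x) \<partial>lborel) \<partial>lborel)"
  proof (rule nn_integral_cong)
    fix y
    have "(\<integral>\<^sup>+x. F y * g (y - f x) \<partial>lborel) = (\<integral>\<^sup>+x. F y * g (y - f (f' y + x)) \<partial>lborel)"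
      by (rule nn_integral_lborel_translate[symmetric]) measurable
    then show "(\<integral>\<^sup>+x. F y * g (y - f x) \<partial>lborel) = F y * (\<integral>\<^sup>+x. g (- f x) \<partial>lborel)"
      by (simp add: add nn_integral_cmult)
  qed
  also have "\<dots> = (\<integral>\<^sup>+x. F x \<partial>lborel) * (\<integral>\<^sup>+x. g (- f x) \<partial>lborel)"
    by (rule nn_integral_multc) measurable
  finally show ?thesis .
qed

text \<open>Take for \<open>g\<close> in the product formula the indicator of the unit ball, whose
  symmetry absorbs the minus sign. The ball has positive finite volume, so it can be divided out;
  the constant is |det f'| as a ratio of volumes.\<close>

lemma nn_integral_linear_scale:
  fixes f :: "'a::euclidean_space \<Rightarrow> 'a"
  assumes f: "linear f" "linear f'" "\<And>x. f (f' x) = x" "\<And>x. f' (f x) = x"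
    and [measurable]: "F \<in> borel_measurable borel"
  shows "(\<integral>\<^sup>+x. F (f x) \<partial>lborel)
       = ennreal (measure lborel (f' ` ball 0 1) / measure lborel (ball (0::'a) 1)) * (\<integral>\<^sup>+x. F x \<partial>lborel)"
    and "measure lborel (f' ` ball 0 1) > 0"
proof -
  let ?g = "indicator (ball (0::'a) 1) :: 'a \<Rightarrow> ennreal"
  have im: "f' ` ball 0 1 = f -` ball 0 1"
    by (auto simp: f(3)) (metis f(4) image_eqI mem_ball_0)
  have cont: "continuous_on UNIV f"
    using f(1) by (simp add: linear_continuous_on linear_conv_bounded_linear)
  have op: "open (f' ` ball 0 1)"
    unfolding im using cont by (simp add: continuous_on_open_vimage)
  have bd: "bounded (f' ` ball 0 1)"
    using f(2) by (intro bounded_linear_image) (auto simp: linear_conv_bounded_linear)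
  have fin: "emeasure lborel (f' ` ball 0 1) < \<infinity>"
    using bd by (rule emeasure_bounded_finite)
  have em: "emeasure lborel (f' ` ball 0 1) = ennreal (measure lborel (f' ` ball 0 1))"
    using fin by (intro emeasure_eq_ennreal_measure) auto
  have emB: "emeasure lborel (ball (0::'a) 1) = ennreal (measure lborel (ball (0::'a) 1))"
    using emeasure_bounded_finite[OF bounded_ball[of "0::'a" 1]]
    by (intro emeasure_eq_ennreal_measure) auto
  have pos: "measure lborel U > 0" if "open U" "bounded U" "U \<noteq> {}" for U :: "'a set"
    using that open_not_negligible[of U] emeasure_bounded_finite[OF \<open>bounded U\<close>]
    by (simp add: negligible_iff_emeasure0 zero_less_measure_iff emeasure_eq_ennreal_measure)
  show "measure lborel (f' ` ball 0 1) > 0"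
    by (rule pos[OF op bd]) simp
  have B: "measure lborel (ball (0::'a) 1) > 0"
    by (rule pos) auto
  have "(\<lambda>x. ?g (- f x)) = indicator (f' ` ball 0 1)"
    by (auto simp: im indicator_def fun_eq_iff)
  then have "(\<integral>\<^sup>+x. ?g (- f x) \<partial>lborel) = ennreal (measure lborel (f' ` ball 0 1))"
    using op by (simp add: em)
  then have "(\<integral>\<^sup>+x. F (f x) \<partial>lborel) * ennreal (measure lborel (ball (0::'a) 1))
      = (\<integral>\<^sup>+x. F x \<partial>lborel) * ennreal (measure lborel (f' ` ball 0 1))"
    using nn_integral_linear_image_mult[of f f' F ?g] f by (simp add: emB borel_measurable_indicator)
  moreover have "ennreal (measure lborel (ball (0::'a) 1)) * ennreal (1 / measure lborel (ball (0::'a) 1)) = 1"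
    using B by (simp add: ennreal_mult[symmetric])
  ultimately have "(\<integral>\<^sup>+x. F (f x) \<partial>lborel)
      = (\<integral>\<^sup>+x. F x \<partial>lborel) * ennreal (measure lborel (f' ` ball 0 1)) * ennreal (1 / measure lborel (ball (0::'a) 1))"
    by (metis mult.assoc mult.right_neutral)
  moreover have "ennreal (measure lborel (f' ` ball 0 1) / measure lborel (ball (0::'a) 1))
      = ennreal (measure lborel (f' ` ball 0 1)) * ennreal (1 / measure lborel (ball (0::'a) 1))"
    by (simp add: ennreal_mult[symmetric])
  ultimately show "(\<integral>\<^sup>+x. F (f x) \<partial>lborel)
       = ennreal (measure lborel (f' ` ball 0 1) / measure lborel (ball (0::'a) 1)) * (\<integral>\<^sup>+x. F x \<partial>lborel)"
    by (simp only: mult_ac)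
qed

text \<open>Cauchy's functional equation. Subtracting \<open>L 1 * t\<close> leaves an additive
  function that vanishes at the integers, hence has period 1 and is bounded above everywhere. Its
  multiples show that it is nowhere positive, and t together with - t gives 0.\<close>

lemma additive_locally_bounded_linear:
  fixes L :: "real \<Rightarrow> real"
  assumes add: "\<And>s t. L (s + t) = L s + L t" and bound: "\<And>t. \<bar>t\<bar> \<le> 1 \<Longrightarrow> L t \<le> B"
  shows "L t = L 1 * t"
proof -
  define D where "D = (\<lambda>t. L t - L 1 * t)"
  have Dadd: "D (s + t) = D s + D t" for s t
    by (simp add: D_def add algebra_simps)
  have D0: "D 0 = 0" using Dadd[of 0 0] by simp
  have Dn: "D (real n * t) = real n * D t" for n t
    by (induction n) (auto simp: Dadd D0 algebra_simps)
  have Dneg: "D (- t) = - D t" for t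
    using Dadd[of t "- t"] D0 by simp
  have D1: "D (of_int n) = 0" for n :: int
  proof -
    have "D (real k) = 0" for k using Dn[of k 1] by (simp add: D_def)
    then have "D (real (nat n)) = 0" "D (- real (nat (- n))) = 0"
      using Dneg by auto
    then show ?thesis by (cases "n \<ge> 0") auto
  qed
  have le: "D t \<le> B + \<bar>L 1\<bar>" for t
  proof -
    have "D t = D (frac t) + D (of_int \<lfloor>t\<rfloor>)"
      by (simp add: Dadd[symmetric] frac_def)
    also have "\<dots> = L (frac t) - L 1 * frac t"
      unfolding D1 by (simp add: D_def)
    also have "\<dots> \<le> B + \<bar>L 1\<bar>"
    proof -
      have f: "0 \<le> frac t" "frac t \<le> 1" using frac_lt_1[of t] by auto
      have "\<bar>L 1 * frac t\<bar> \<le> \<bar>L 1\<bar> * 1" unfolding abs_mult using f by (intro mult_left_mono) auto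
      then show ?thesis using bound[of "frac t"] f by auto
    qed
    finally show ?thesis .
  qed
  have "D t \<le> 0" for t
  proof (rule ccontr)
    assume "\<not> D t \<le> 0"
    then obtain n where "real n * D t > B + \<bar>L 1\<bar>"
      using reals_Archimedean3[of "D t"] by auto
    then show False using le[of "real n * t"] Dn by simp
  qed
  from this[of t] this[of "- t"] have "D t = 0" by (simp add: Dneg)
  then show ?thesis by (simp add: D_def)
qed

section \<open>The linear flow\<close>

definition flow :: "real^'n^'n \<Rightarrow> real \<Rightarrow> real^'n \<Rightarrow> real^'n" where
  "flow A t x = matrix_exp (t *\<^sub>R A) *v x"

lemma flow_0 [simp]: "flow A 0 x = x"
  by (simp add: flow_def matrix_exp_0)

lemma flow_add: "flow A (s + t) x = flow A s (flow A t x)"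
  by (simp add: flow_def matrix_exp_add matrix_vector_mul_assoc)

lemma flow_minus [simp]: "flow A (- t) (flow A t x) = x" "flow A t (flow A (- t) x) = x"
  by (simp_all flip: flow_add)

lemma linear_flow: "linear (flow A t)"
  unfolding flow_def by simp

lemma has_vector_derivative_flow:
  "((\<lambda>t. flow A t x) has_vector_derivative A *v flow A t x) (at t)"
  unfolding flow_def matrix_vector_mul_assoc
  by (rule bounded_linear.has_vector_derivative[OF
        bounded_bilinear.bounded_linear_left[OF bounded_bilinear_matrix_vector_mult]
        has_vector_derivative_matrix_exp])

lemma continuous_on_flow [continuous_intros]:
  assumes "continuous_on S f" "continuous_on S g"
  shows "continuous_on S (\<lambda>y. flow A (f y) (g y))"
proof -
  have "continuous_on UNIV (\<lambda>t. matrix_exp (t *\<^sub>R A))"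
    using has_vector_derivative_matrix_exp
    by (intro continuous_at_imp_continuous_on ballI has_vector_derivative_continuous)
  then have "continuous_on S (\<lambda>y. matrix_exp (f y *\<^sub>R A))"
    using assms(1) by (rule continuous_on_compose2) auto
  then show ?thesis
    unfolding flow_def
    by (intro bounded_bilinear.continuous_on[OF bounded_bilinear_matrix_vector_mult] assms(2))
qed

lemma measurable_flow [measurable (raw)]:
  assumes [measurable]: "f \<in> borel_measurable M" "g \<in> borel_measurable M"
  shows "(\<lambda>y. flow A (f y) (g y)) \<in> borel_measurable M"
proof -
  have "(\<lambda>y. flow A (fst y) (snd y)) \<in> borel_measurable (borel \<Otimes>\<^sub>M borel)"
    by (subst borel_prod) (intro borel_measurable_continuous_onI continuous_intros)
  then show ?thesis
    using measurable_compose[OF measurable_Pair[OF assms], of "\<lambda>y. flow A (fst y) (snd y)" borel] by simp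
qed

text \<open>The scaling factors multiply when times add, so their logarithm solves Cauchy's
  equation. The factor being |det (exp (- t A))|, the number \<open>a\<close> is minus the trace of
  \<open>A\<close>.\<close>

lemma nn_integral_flow:
  fixes A :: "real^'n^'n"
  obtains a where "\<And>t F. F \<in> borel_measurable borel \<Longrightarrow>
    (\<integral>\<^sup>+x. F (flow A t x) \<partial>lborel) = ennreal (exp (a * t)) * (\<integral>\<^sup>+x. F x \<partial>lborel)"
proof -
  define B where "B = measure lborel (ball (0::real^'n) 1)"
  define c where "c = (\<lambda>t. measure lborel (flow A (- t) ` ball 0 1) / B)"
  \<comment> \<open>\<open>flow A 0\<close> is the identity, so the image whose volume is positive
    is the ball itself; the integrand \<open>\<lambda>_. 0\<close> is a placeholder.\<close>
  have B: "B > 0"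
    using nn_integral_linear_scale(2)[of "flow A 0" "flow A 0" "\<lambda>_. 0"]
    by (simp add: B_def linear_flow)
  have emB: "emeasure lborel (ball (0::real^'n) 1) = ennreal B"
    unfolding B_def using emeasure_bounded_finite[OF bounded_ball[of "0::real^'n" 1]]
    by (intro emeasure_eq_ennreal_measure) auto
  have scale: "(\<integral>\<^sup>+x. F (flow A t x) \<partial>lborel) = ennreal (c t) * (\<integral>\<^sup>+x. F x \<partial>lborel)"
    if "F \<in> borel_measurable borel" for F t
    unfolding c_def B_def using that by (intro nn_integral_linear_scale(1)) (auto simp: linear_flow)
  have cpos: "c t > 0" for t
    unfolding c_def using B nn_integral_linear_scale(2)[of "flow A t" "flow A (- t)" "\<lambda>_. 0"]
    by (auto simp: linear_flow)
  have cadd: "c (s + t) = c s * c t" for s t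
  proof -
    let ?g = "indicator (ball 0 1) :: real^'n \<Rightarrow> ennreal"
    have g [measurable]: "?g \<in> borel_measurable borel"
      by (rule borel_measurable_indicator) simp
    have "ennreal (c (s + t)) * ennreal B = (\<integral>\<^sup>+x. ?g (flow A (s + t) x) \<partial>lborel)"
      by (subst scale[OF g]) (simp add: emB)
    also have "\<dots> = (\<integral>\<^sup>+x. ?g (flow A s (flow A t x)) \<partial>lborel)"
      by (simp add: flow_add)
    also have "\<dots> = ennreal (c t) * (\<integral>\<^sup>+x. ?g (flow A s x) \<partial>lborel)"
      by (rule scale) measurable
    also have "\<dots> = ennreal (c t) * (ennreal (c s) * ennreal B)"
      by (subst scale[OF g]) (simp add: emB)
    finally have "ennreal (c (s + t) * B) = ennreal (c t * (c s * B))"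
      using cpos B by (simp add: ennreal_mult less_imp_le)
    then have "c (s + t) * B = c t * (c s * B)"
      using cpos B by (simp add: less_imp_le)
    then show ?thesis using B by simp
  qed
  \<comment> \<open>For |t| \<le> 1 all images of the unit ball lie in one ball, which gives the
    local upper bound for \<open>c\<close> used in Cauchy's equation.\<close>
  have "compact ((\<lambda>y. flow A (fst y) (snd y)) ` ({-1..1} \<times> cball 0 1))"
    by (intro compact_continuous_image continuous_intros compact_Times) auto
  then obtain K where K: "\<And>t x. \<bar>t\<bar> \<le> 1 \<Longrightarrow> norm x \<le> 1 \<Longrightarrow> norm (flow A t x) \<le> K"
    unfolding compact_eq_bounded_closed bounded_iff by force
  have cbound: "c t \<le> measure lborel (cball (0::real^'n) K) / B" if "\<bar>t\<bar> \<le> 1" for t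
  proof -
    have "flow A (- t) ` ball 0 1 \<in> sets lborel"
    proof -
      have "flow A (- t) ` ball 0 1 = flow A t -` ball 0 1 \<inter> space borel"
        by auto (metis flow_minus(1) image_eqI mem_ball_0)
      moreover have "flow A t -` ball 0 1 \<inter> space borel \<in> sets borel"
        by (rule measurable_sets) measurable
      ultimately show ?thesis by simp
    qed
    moreover have "cball (0::real^'n) K \<in> fmeasurable lborel"
      using emeasure_bounded_finite[OF bounded_cball[of "0::real^'n" K]] by (intro fmeasurableI) auto
    ultimately have "measure lborel (flow A (- t) ` ball 0 1) \<le> measure lborel (cball (0::real^'n) K)"
      using K[of "- t"] that by (intro measure_mono_fmeasurable) auto
    then show ?thesis using B by (simp add: c_def divide_right_mono)
  qed
  have "ln (c t) = ln (c 1) * t" for t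
  proof (rule additive_locally_bounded_linear)
    show "ln (c (s + t)) = ln (c s) + ln (c t)" for s t
      by (simp add: cadd ln_mult_pos cpos)
    show "ln (c t) \<le> ln (measure lborel (cball (0::real^'n) K) / B)" if "\<bar>t\<bar> \<le> 1" for t
      using cbound[OF that] cpos[of t] by simp
  qed
  then have "c t = exp (ln (c 1) * t)" for t
    using cpos by (metis exp_ln)
  then show ?thesis
    using scale that by metis
qed

text \<open>At fixed \<open>t\<close> the substitution x = flow A t y produces the factor exp (a t),
  which the weight cancels. For fixed \<open>x\<close> there remains the set of times at which the
  backward orbit meets the slab; since \<tau> moves at unit speed, it lies in an interval of length
  2 k.\<close>

lemma AE_orbit_finite:
  fixes A :: "real^'n^'n" and F :: "real^'n \<Rightarrow> ennreal" and \<tau> :: "real^'n \<Rightarrow> real"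
  assumes [measurable]: "F \<in> borel_measurable borel" "\<tau> \<in> borel_measurable borel" "\<Omega> \<in> sets borel"
    and fin: "(\<integral>\<^sup>+x. F x \<partial>lborel) < \<infinity>"
    and scale: "\<And>t F. F \<in> borel_measurable borel \<Longrightarrow>
      (\<integral>\<^sup>+x. F (flow A t x) \<partial>lborel) = ennreal (exp (a * t)) * (\<integral>\<^sup>+x. F x \<partial>lborel)"
    and inv: "\<And>t x. x \<in> \<Omega> \<Longrightarrow> flow A t x \<in> \<Omega>"
    and \<tau>: "\<And>t x. x \<in> \<Omega> \<Longrightarrow> \<tau> (flow A t x) = \<tau> x + t"
  shows "AE y in lborel. y \<in> \<Omega> \<longrightarrow> (\<integral>\<^sup>+t. F (flow A t y) * ennreal (exp (- a * t)) \<partial>lborel) < \<infinity>"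
proof -
  have "AE y in lborel. y \<in> \<Omega> \<and> \<bar>\<tau> y\<bar> \<le> real k \<longrightarrow>
      (\<integral>\<^sup>+t. F (flow A t y) * ennreal (exp (- a * t)) \<partial>lborel) < \<infinity>" for k
  proof -
    define D where "D = {y \<in> \<Omega>. \<bar>\<tau> y\<bar> \<le> real k}"
    have [measurable]: "D \<in> sets borel" unfolding D_def by measurable
    have "(\<integral>\<^sup>+y. (\<integral>\<^sup>+t. indicator D y * (F (flow A t y) * ennreal (exp (- a * t))) \<partial>lborel) \<partial>lborel)
        = (\<integral>\<^sup>+t. (\<integral>\<^sup>+y. indicator D y * (F (flow A t y) * ennreal (exp (- a * t))) \<partial>lborel) \<partial>lborel)"
      by (rule lborel_pair.Fubini') measurable
    also have "\<dots> = (\<integral>\<^sup>+t. (\<integral>\<^sup>+x. indicator D (flow A (- t) x) * F x \<partial>lborel) \<partial>lborel)"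
    proof (rule nn_integral_cong)
      fix t
      have m: "(\<lambda>x. indicator D (flow A (- t) x) * F x) \<in> borel_measurable borel"
        by measurable
      have "(\<integral>\<^sup>+y. indicator D y * (F (flow A t y) * ennreal (exp (- a * t))) \<partial>lborel)
          = (\<integral>\<^sup>+y. indicator D (flow A (- t) (flow A t y)) * F (flow A t y) * ennreal (exp (- a * t)) \<partial>lborel)"
        by (simp add: mult.assoc)
      also have "\<dots> = (\<integral>\<^sup>+y. indicator D (flow A (- t) (flow A t y)) * F (flow A t y) \<partial>lborel) * ennreal (exp (- a * t))"
        by (rule nn_integral_multc) measurable
      also have "\<dots> = ennreal (exp (a * t)) * (\<integral>\<^sup>+x. indicator D (flow A (- t) x) * F x \<partial>lborel) * ennreal (exp (- a * t))"
        by (subst scale[OF m]) simp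
      also have "\<dots> = ennreal (exp (a * t) * exp (- a * t)) * (\<integral>\<^sup>+x. indicator D (flow A (- t) x) * F x \<partial>lborel)"
        by (simp add: ennreal_mult mult_ac)
      also have "exp (a * t) * exp (- a * t) = 1"
        by (simp flip: exp_add)
      finally show "(\<integral>\<^sup>+y. indicator D y * (F (flow A t y) * ennreal (exp (- a * t))) \<partial>lborel)
          = (\<integral>\<^sup>+x. indicator D (flow A (- t) x) * F x \<partial>lborel)"
        by simp
    qed
    also have "\<dots> = (\<integral>\<^sup>+x. (\<integral>\<^sup>+t. indicator D (flow A (- t) x) * F x \<partial>lborel) \<partial>lborel)"
      by (rule lborel_pair.Fubini') measurable
    also have "\<dots> \<le> (\<integral>\<^sup>+x. ennreal (2 * real k) * F x \<partial>lborel)"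
    proof (rule nn_integral_mono)
      fix x :: "real^'n"
      have "(\<integral>\<^sup>+t. indicator D (flow A (- t) x) * F x \<partial>lborel) \<le> (\<integral>\<^sup>+t. indicator {\<tau> x - real k..\<tau> x + real k} t * F x \<partial>lborel)"
      proof (rule nn_integral_mono)
        fix t
        show "indicator D (flow A (- t) x) * F x \<le> indicator {\<tau> x - real k..\<tau> x + real k} t * F x"
        proof (cases "flow A (- t) x \<in> D")
          case True
          then have "flow A (- t) x \<in> \<Omega>" "\<bar>\<tau> (flow A (- t) x)\<bar> \<le> real k" by (auto simp: D_def)
          moreover have "\<tau> x = \<tau> (flow A (- t) x) + t"
            using \<tau>[OF \<open>flow A (- t) x \<in> \<Omega>\<close>, of t] by simp
          ultimately show ?thesis by (auto simp: indicator_def)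
        qed simp
      qed
      also have "\<dots> = ennreal (2 * real k) * F x"
        by (simp add: nn_integral_multc)
      finally show "(\<integral>\<^sup>+t. indicator D (flow A (- t) x) * F x \<partial>lborel) \<le> ennreal (2 * real k) * F x" .
    qed
    also have "\<dots> = ennreal (2 * real k) * (\<integral>\<^sup>+x. F x \<partial>lborel)"
      by (rule nn_integral_cmult) measurable
    also have "\<dots> < \<infinity>"
      using fin by (simp add: ennreal_mult_less_top)
    finally have lt: "(\<integral>\<^sup>+y. (\<integral>\<^sup>+t. indicator D y * (F (flow A t y) * ennreal (exp (- a * t))) \<partial>lborel) \<partial>lborel) < \<infinity>" .
    have "(\<lambda>y. \<integral>\<^sup>+t. indicator D y * (F (flow A t y) * ennreal (exp (- a * t))) \<partial>lborel) \<in> borel_measurable lborel"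
      by measurable
    then have "AE y in lborel. (\<integral>\<^sup>+t. indicator D y * (F (flow A t y) * ennreal (exp (- a * t))) \<partial>lborel) \<noteq> \<infinity>"
      by (rule nn_integral_PInf_AE) (use lt in auto)
    then show ?thesis
      by eventually_elim (auto simp: D_def less_top[symmetric])
  qed
  then have "AE y in lborel. \<forall>k::nat. y \<in> \<Omega> \<and> \<bar>\<tau> y\<bar> \<le> real k \<longrightarrow>
      (\<integral>\<^sup>+t. F (flow A t y) * ennreal (exp (- a * t)) \<partial>lborel) < \<infinity>"
    unfolding AE_all_countable by blast
  then show ?thesis
    by eventually_elim (use real_arch_simple in blast)
qed

text \<open>Along an orbit, l and l' solve u' = \<mu> u and w' = \<mu> w + u. After multiplication
  by exp (- \<mu> t), the first is constant and the second grows at the constant rate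
  \<open>l x\<close>.\<close>

lemma jordan_chain_flow:
  fixes A :: "real^'n^'n" and l l' :: "real^'n \<Rightarrow> complex"
  assumes l: "linear l" "\<And>v. l (A *v v) = \<mu> * l v"
  shows "l (flow A t x) = exp (\<mu> * of_real t) * l x"
    and "linear l' \<Longrightarrow> (\<And>v. l' (A *v v) = \<mu> * l' v + l v) \<Longrightarrow>
           l' (flow A t x) = exp (\<mu> * of_real t) * (l' x + of_real t * l x)"
proof -
  have ex: "((\<lambda>t. exp (- \<mu> * of_real t)) has_vector_derivative - \<mu> * exp (- \<mu> * of_real t)) (at t)" for t
  proof -
    have "((\<lambda>z. exp (- \<mu> * z)) has_field_derivative - \<mu> * exp (- \<mu> * of_real t)) (at (of_real t))"
      by (auto intro!: derivative_eq_intros)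
    then show ?thesis
      by (rule has_vector_derivative_real_field)
  qed
  have fl: "((\<lambda>t. f (flow A t x)) has_vector_derivative f (A *v flow A t x)) (at t)"
    if "linear f" for f :: "real^'n \<Rightarrow> complex" and t
    using that by (intro bounded_linear.has_vector_derivative[OF _ has_vector_derivative_flow])
      (simp add: linear_conv_bounded_linear)
  have const: "u t = u 0" if "\<And>t. (u has_vector_derivative 0) (at t)" for u :: "real \<Rightarrow> complex"
    using has_vector_derivative_zero_constant[of UNIV u] that[THEN has_vector_derivative_at_within]
    by (metis UNIV_I convex_UNIV)
  have cancel: "y = exp (\<mu> * of_real t) * z" if "exp (- \<mu> * of_real t) * y = z" for y z
    using that by (auto simp: exp_minus field_simps)
  have l_eq: "exp (- \<mu> * of_real t) * l (flow A t x) = l x" for t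
  proof -
    have "((\<lambda>t. exp (- \<mu> * of_real t) * l (flow A t x)) has_vector_derivative 0) (at t)" for t
      using has_vector_derivative_mult[OF ex fl[OF l(1)], of t] by (simp add: l(2))
    from has_vector_derivative_zero_constant[of UNIV, OF _ this[THEN has_vector_derivative_at_within]]
    show ?thesis by (metis UNIV_I convex_UNIV flow_0 mult_zero_right of_real_0 exp_zero mult_1)
  qed
  show "l (flow A t x) = exp (\<mu> * of_real t) * l x"
    by (rule cancel) (rule l_eq)
  show "l' (flow A t x) = exp (\<mu> * of_real t) * (l' x + of_real t * l x)"
    if l': "linear l'" "\<And>v. l' (A *v v) = \<mu> * l' v + l v"
  proof (rule cancel)
    have "((\<lambda>t. exp (- \<mu> * of_real t) * l' (flow A t x)) has_vector_derivative l x) (at t)" for t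
    proof -
      have "exp (- \<mu> * of_real t) * (\<mu> * l' (flow A t x) + l (flow A t x))
          + - \<mu> * exp (- \<mu> * of_real t) * l' (flow A t x) = l x"
        using l_eq[of t] by (simp add: algebra_simps)
      then show ?thesis
        using has_vector_derivative_mult[OF ex fl[OF l'(1)], of t] unfolding l'(2) by simp
    qed
    moreover have "((\<lambda>t. of_real t * l x) has_vector_derivative l x) (at t)" for t
      by (auto intro!: derivative_eq_intros)
    ultimately have "((\<lambda>t. exp (- \<mu> * of_real t) * l' (flow A t x) - of_real t * l x) has_vector_derivative 0) (at t)" for t
      using has_vector_derivative_diff by fastforce
    from const[OF this] show "exp (- \<mu> * of_real t) * l' (flow A t x) = l' x + of_real t * l x"
      by (simp add: algebra_simps)
  qed
qed

section \<open>Jordan coordinates and the set \<Omega>\<close>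

lemma iota_cong:
  assumes "\<And>j. j < r + 2 * h \<Longrightarrow> v j = w j" "i < r + 2 * h"
  shows "iota r h v i = iota r h w i"
  using assms by (auto simp: iota_def)

lemma linear_iota:
  assumes "\<And>j. j < r + 2 * h \<Longrightarrow> linear (\<lambda>v. X v j)" "i < r + 2 * h"
  shows "linear (\<lambda>v. iota r h (X v) i)"
proof -
  have "X (x + y) j = X x j + X y j" "X (c *\<^sub>R x) j = c * X x j" if "j < r + 2 * h" for j x y c
    using linear_add[OF assms(1)[OF that]] linear_scale[OF assms(1)[OF that]] by auto
  then show ?thesis
    using assms(2) by (intro linearI) (auto simp: iota_def scaleR_conv_of_real ring_distribs)
qed

text \<open>The vector of ones has coordinates 1, 1 + \<i> and 1 - \<i>, and so witnesses that no
  coordinate functional is zero.\<close>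

lemma iota_ne_0: "i < r + 2 * h \<Longrightarrow> iota r h (\<lambda>_. 1) i \<noteq> 0"
  by (auto simp: iota_def complex_eq_iff)

text \<open>Besides the diagonal, a row meets only the entry to its left. The guard
  \<open>a < i\<close> drops that entry in the first row of the block, where column
  \<open>i - 1\<close> lies outside the block or, for i = 0, is truncated to 0.\<close>

lemma jordan_block_row_sum:
  fixes M :: "nat \<Rightarrow> nat \<Rightarrow> complex"
  assumes "jordan_block_at n M a b \<mu>" "i \<in> {a..<b}"
  shows "(\<Sum>j<n. M i j * y j) = \<mu> * y i + (if a < i then M i (i - 1) * y (i - 1) else 0)"
proof -
  have ab: "a < b" "b \<le> n" and
    blk: "\<And>j. j \<in> {a..<b} \<Longrightarrow> (i = j \<longrightarrow> M i j = \<mu>) \<and> (i \<noteq> j \<and> i \<noteq> Suc j \<longrightarrow> M i j = 0)" and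
    off: "\<And>j. j < n \<Longrightarrow> j \<notin> {a..<b} \<Longrightarrow> M i j = 0"
    using assms unfolding jordan_block_at_def by auto
  let ?S = "if a < i then {i, i - 1} else {i}"
  have "(\<Sum>j<n. M i j * y j) = (\<Sum>j\<in>?S. M i j * y j)"
  proof (rule sum.mono_neutral_right)
    show "\<forall>j\<in>{..<n} - ?S. M i j * y j = 0"
    proof
      fix j assume j: "j \<in> {..<n} - ?S"
      have "M i j = 0"
      proof (cases "j \<in> {a..<b}")
        case True
        then have "i \<noteq> j" "i \<noteq> Suc j" using j by (auto split: if_splits)
        then show ?thesis using blk[OF True] by blast
      qed (use off j in auto)
      then show "M i j * y j = 0" by simp
    qed
  qed (use ab assms(2) in auto)
  also have "\<dots> = \<mu> * y i + (if a < i then M i (i - 1) * y (i - 1) else 0)"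
    using blk[OF assms(2)] by auto
  finally show ?thesis .
qed

text \<open>Composing a coordinate with \<open>A\<close> reads off a row of \<open>M\<close>, so a
  row without subdiagonal entry gives an eigenfunctional. The second case of the definition is
  \<open>first\<close>; the other two differ only in the eigenvalue and share \<open>chain\<close>.
  The point \<open>w\<close> shows that the kernel of \<open>l\<close> is proper.\<close>

lemma is_Omega_eigenfunctional:
  fixes A :: "real^'n^'n"
  assumes "is_Omega A \<Omega>"
  obtains l \<mu> w where "linear l" "\<And>v. l (A *v v) = \<mu> * l v" "l w \<noteq> 0" "\<Omega> = {v. l v \<noteq> 0}"
    "Re \<mu> \<noteq> 0 \<or> (\<exists>l'. linear l' \<and> (\<forall>v. l' (A *v v) = \<mu> * l' v + l v))"
proof -
  note result = that
  obtain X r h J M k where n: "r + 2 * h = CARD('n)"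
    and X: "linear_coordinates X" and J: "matrix_in_coordinates A X J"
    and M: "iota_conjugate r h J M" and k: "omega_index (r + 2 * h) M k"
    and \<Omega>: "\<Omega> = {v. iota r h (X v) k \<noteq> 0}"
    using assms unfolding is_Omega_def by blast
  define l where "l = (\<lambda>i v. iota r h (X v) i)"
  have lin: "linear (l i)" if "i < r + 2 * h" for i
    unfolding l_def using X n that by (intro linear_iota) (auto simp: linear_coordinates_def)
  have act: "l i (A *v v) = (\<Sum>j<r + 2 * h. M i j * l j v)" if "i < r + 2 * h" for i v
  proof -
    have "l i (A *v v) = iota r h (\<lambda>k. \<Sum>j<r + 2 * h. J k j * X v j) i"
      unfolding l_def using J n that by (intro iota_cong) (auto simp: matrix_in_coordinates_def)
    then show ?thesis
      using M that by (auto simp: iota_conjugate_def l_def)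
  qed
  have "restrict (\<lambda>_. 1) {..<CARD('n)} \<in> {..<CARD('n)} \<rightarrow>\<^sub>E (UNIV :: real set)"
    by auto
  then obtain w where w: "restrict (X w) {..<CARD('n)} = restrict (\<lambda>_. 1) {..<CARD('n)}"
    using X unfolding linear_coordinates_def bij_betw_def by (metis (no_types, lifting) imageE)
  have lw: "l i w \<noteq> 0" if "i < r + 2 * h" for i
  proof -
    have "X w j = 1" if "j < r + 2 * h" for j
      using fun_cong[OF w, of j] that n by simp
    then have "l i w = iota r h (\<lambda>_. 1) i"
      unfolding l_def using that by (intro iota_cong) auto
    then show ?thesis using iota_ne_0[OF that] by simp
  qed
  have first: thesis if blk: "jordan_block_at (r + 2 * h) M a b \<mu>" and "Re \<mu> \<noteq> 0" "k = a" for a b \<mu>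
  proof -
    have "a \<in> {a..<b}" "a < r + 2 * h" using blk by (auto simp: jordan_block_at_def)
    then show thesis
      using result[of "l a" \<mu> w] lin lw act jordan_block_row_sum[OF blk] \<open>Re \<mu> \<noteq> 0\<close> \<open>k = a\<close> \<Omega>
      by (simp add: l_def)
  qed
  have chain: thesis if blk: "jordan_block_at (r + 2 * h) M a b \<mu>"
    and row: "first_subdiagonal_row M a b i" and "k = i - 1" for a b \<mu> i
  proof -
    have i: "a < i" "i < b" "M i (i - 1) \<noteq> 0" "\<And>j. a < j \<Longrightarrow> j < i \<Longrightarrow> M j (j - 1) = 0"
      using row by (auto simp: first_subdiagonal_row_def)
    have b: "b \<le> r + 2 * h" and sub: "\<And>i j. i \<in> {a..<b} \<Longrightarrow> j \<in> {a..<b} \<Longrightarrow> i = Suc j \<Longrightarrow> M i j \<in> {0, 1}"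
      using blk unfolding jordan_block_at_def by blast+
    have Mi: "M i (i - 1) = 1"
    proof -
      have "i \<in> {a..<b}" "i - 1 \<in> {a..<b}" "i = Suc (i - 1)" using i by auto
      from sub[OF this] show ?thesis using i(3) by simp
    qed
    have k: "k \<in> {a..<b}" "i \<in> {a..<b}" "k < r + 2 * h" "i < r + 2 * h"
      using i b \<open>k = i - 1\<close> by auto
    \<comment> \<open>By minimality of row \<open>i\<close>, the row \<open>k\<close> before it has
      no subdiagonal entry in the block, so \<open>l k\<close> is an eigenfunctional and
      \<open>l i\<close> is next in its chain.\<close>
    have "M k (k - 1) = 0" if "a < k"
      using i(4)[of k] that i(1) \<open>k = i - 1\<close> by simp
    then have "l k (A *v v) = \<mu> * l k v" for v
      using act[OF k(3), of v] jordan_block_row_sum[OF blk k(1), of "\<lambda>j. l j v"] by simp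
    moreover have "l i (A *v v) = \<mu> * l i v + l k v" for v
      using act[OF k(4), of v] jordan_block_row_sum[OF blk k(2), of "\<lambda>j. l j v"] i Mi \<open>k = i - 1\<close> by auto
    ultimately show thesis
      using result[of "l k" \<mu> w] lin lw k \<Omega> by (auto simp: l_def)
  qed
  show thesis
    using k unfolding omega_index_def by (auto split: if_splits intro: first chain)
qed

lemma is_Omega_time_function:
  fixes A :: "real^'n^'n"
  assumes "is_Omega A \<Omega>"
  obtains \<tau> :: "real^'n \<Rightarrow> real" where "\<tau> \<in> borel_measurable borel" "\<Omega> \<in> sets borel" "negligible (- \<Omega>)"
    "\<And>t x. x \<in> \<Omega> \<Longrightarrow> flow A t x \<in> \<Omega>" "\<And>t x. x \<in> \<Omega> \<Longrightarrow> \<tau> (flow A t x) = \<tau> x + t"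
proof -
  obtain l \<mu> w where l: "linear l" "\<And>v. l (A *v v) = \<mu> * l v" "l w \<noteq> 0" "\<Omega> = {v. l v \<noteq> 0}"
    "Re \<mu> \<noteq> 0 \<or> (\<exists>l'. linear l' \<and> (\<forall>v. l' (A *v v) = \<mu> * l' v + l v))"
    using is_Omega_eigenfunctional[OF assms] by blast
  have meas: "f \<in> borel_measurable borel" if "linear f" for f :: "real^'n \<Rightarrow> complex"
    using that by (intro borel_measurable_continuous_onI linear_continuous_on) (simp add: linear_conv_bounded_linear)
  note [measurable] = meas[OF l(1)]
  have \<Omega>: "\<Omega> \<in> sets borel" unfolding l(4) by measurable
  have neg: "negligible (- \<Omega>)"
  proof (rule negligible_lowdim)
    \<comment> \<open>The complement is the kernel of the real-linear map \<open>l\<close>; as it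
      misses \<open>w\<close>, its dimension is too small for positive measure.\<close>
    have "subspace (- \<Omega>)"
      unfolding l(4) using l(1) by (auto simp: subspace_def linear_0 linear_add linear_scale)
    moreover have "w \<notin> - \<Omega>" using l(3,4) by simp
    ultimately show "dim (- \<Omega>) < DIM(real^'n)"
      by (metis UNIV_I dim_eq_full dim_subset_UNIV le_neq_implies_less span_eq_iff)
  qed
  have fl: "l (flow A t x) = exp (\<mu> * of_real t) * l x" for t x
    by (rule jordan_chain_flow(1)[OF l(1,2)])
  have inv: "flow A t x \<in> \<Omega>" if "x \<in> \<Omega>" for t x
    using that by (simp add: l(4) fl)
  show thesis
  proof (cases "Re \<mu> = 0")
    case False
    show thesis
    proof (rule that[OF _ \<Omega> neg inv])
      show "(\<lambda>x. ln (norm (l x)) / Re \<mu>) \<in> borel_measurable borel" by measurable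
      show "ln (norm (l (flow A t x))) / Re \<mu> = ln (norm (l x)) / Re \<mu> + t" if "x \<in> \<Omega>" for t x
        using that False by (simp add: fl l(4) norm_mult ln_mult_pos add_divide_distrib)
    qed
  next
    case True
    then obtain l' where l': "linear l'" "\<And>v. l' (A *v v) = \<mu> * l' v + l v" using l(5) by blast
    note [measurable] = meas[OF l'(1)]
    show thesis
    proof (rule that[OF _ \<Omega> neg inv])
      show "(\<lambda>x. Re (l' x / l x)) \<in> borel_measurable borel" by measurable
      show "Re (l' (flow A t x) / l (flow A t x)) = Re (l' x / l x) + t" if "x \<in> \<Omega>" for t x
      proof -
        have "l' (flow A t x) / l (flow A t x) = l' x / l x + of_real t"
          using that by (simp add: fl jordan_chain_flow(2)[OF l(1,2) l'] l(4) field_simps)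
        then show ?thesis by simp
      qed
    qed
  qed
qed

theorem corollary15:
  fixes A :: "real^'n^'n"
    and \<Omega> :: "(real^'n) set"
    and p :: real and m :: nat
    and t :: "nat \<Rightarrow> real" and c :: "nat \<Rightarrow> complex"
  assumes "closedin (top_of_set general_linear_group) (one_param_group A)"
    and "one_param_group A \<noteq> {mat 1}"
    and "imaginary_eigenvalues A \<noteq> {} \<longrightarrow>
           rat_complex.dim (rat_complex.span (imaginary_eigenvalues A)) = 1"
    and "is_Omega A \<Omega>"
    and "acts_freely_on A \<Omega>"
    and "1 \<le> p"
    and "m > 2"
    and "inj_on t {1..m}"
    and "\<exists>k\<in>{1..m}. c k \<noteq> 0"
  shows "\<not> (\<exists>\<phi> :: real^'n \<Rightarrow> complex.
            in_Lp p \<phi> \<and> continuous_on UNIV \<phi> \<and> \<phi> \<noteq> (\<lambda>x. 0) \<and>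
            (\<forall>x. (\<Sum>k=1..m. c k * \<phi> (matrix_exp (t k *\<^sub>R A) *v x)) = 0))"
proof
  assume "\<exists>\<phi> :: real^'n \<Rightarrow> complex.
            in_Lp p \<phi> \<and> continuous_on UNIV \<phi> \<and> \<phi> \<noteq> (\<lambda>x. 0) \<and>
            (\<forall>x. (\<Sum>k=1..m. c k * \<phi> (matrix_exp (t k *\<^sub>R A) *v x)) = 0)"
  then obtain \<phi> :: "real^'n \<Rightarrow> complex" where Lp: "in_Lp p \<phi>" and cont: "continuous_on UNIV \<phi>"
    and nz: "\<phi> \<noteq> (\<lambda>x. 0)" and eq: "\<And>x. (\<Sum>k=1..m. c k * \<phi> (flow A (t k) x)) = 0"
    unfolding flow_def by blast
  obtain \<tau> where \<tau>: "\<tau> \<in> borel_measurable borel" "\<Omega> \<in> sets borel" "negligible (- \<Omega>)"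
    "\<And>t x. x \<in> \<Omega> \<Longrightarrow> flow A t x \<in> \<Omega>" "\<And>t x. x \<in> \<Omega> \<Longrightarrow> \<tau> (flow A t x) = \<tau> x + t"
    using is_Omega_time_function[OF \<open>is_Omega A \<Omega>\<close>] by blast
  obtain a where a: "\<And>t F. F \<in> borel_measurable borel \<Longrightarrow>
      (\<integral>\<^sup>+x. F (flow A t x) \<partial>lborel) = ennreal (exp (a * t)) * (\<integral>\<^sup>+x. F x \<partial>lborel)"
    using nn_integral_flow[of A] by blast
  have [measurable]: "\<phi> \<in> borel_measurable borel"
    using cont by (rule borel_measurable_continuous_onI)
  define F where "F = (\<lambda>x. ennreal (norm (\<phi> x) powr p))"
  have orbit: "\<phi> y = 0" if fin: "(\<integral>\<^sup>+s. F (flow A s y) * ennreal (exp (- a * s)) \<partial>lborel) < \<infinity>" for y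
  proof -
    \<comment> \<open>The division by \<open>p\<close> turns the factor into the weight exp (- a s)
      once the norm is raised to the power \<open>p\<close>.\<close>
    define g where "g = (\<lambda>s. \<phi> (flow A s y) * of_real (exp (- a * s / p)))"
    have contg: "continuous_on UNIV g"
      unfolding g_def using \<open>1 \<le> p\<close> by (intro continuous_intros continuous_on_compose2[OF cont]) auto
    have [measurable]: "g \<in> borel_measurable borel"
      using contg by (rule borel_measurable_continuous_onI)
    have "norm (g s) powr p = norm (\<phi> (flow A s y)) powr p * exp (- a * s)" for s
    proof -
      have "exp (- a * s / p) powr p = exp (- a * s)"
        using \<open>1 \<le> p\<close> by (simp add: powr_def)
      then show ?thesis by (simp add: g_def norm_mult powr_mult)
    qed
    then have "(\<integral>\<^sup>+s. ennreal (norm (g s) powr p) \<partial>lborel) = (\<integral>\<^sup>+s. F (flow A s y) * ennreal (exp (- a * s)) \<partial>lborel)"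
      by (simp add: F_def ennreal_mult)
    then have "integrable lborel (\<lambda>s. norm (g s) powr p)"
      using fin by (intro integrableI_nonneg) auto
    \<comment> \<open>The factor at time s + t k splits into one depending on \<open>s\<close> alone
      and exp (- a t k / p); the latter is compensated in the coefficients.\<close>
    moreover have "(\<Sum>k=1..m. c k * of_real (exp (a * t k / p)) * g (s + t k)) = 0" for s
    proof -
      have "c k * of_real (exp (a * t k / p)) * g (s + t k)
          = of_real (exp (- a * s / p)) * (c k * \<phi> (flow A (t k) (flow A s y)))" for k
      proof -
        have "complex_of_real (exp (a * t k / p)) * of_real (exp (- a * (s + t k) / p)) = of_real (exp (- a * s / p))"
          using \<open>1 \<le> p\<close> by (simp flip: of_real_mult exp_add add: field_simps)
        then show ?thesis
          by (simp add: g_def mult_ac add.commute[of s] flow_add)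
      qed
      then have "(\<Sum>k=1..m. c k * of_real (exp (a * t k / p)) * g (s + t k))
          = of_real (exp (- a * s / p)) * (\<Sum>k=1..m. c k * \<phi> (flow A (t k) (flow A s y)))"
        by (simp only: sum_distrib_left)
      then show ?thesis by (simp only: eq mult_zero_right)
    qed
    moreover have "\<exists>k\<in>{1..m}. c k * of_real (exp (a * t k / p)) \<noteq> 0"
      using assms by auto
    ultimately have "g 0 = 0"
      using contg \<open>1 \<le> p\<close> \<open>inj_on t {1..m}\<close>
      by (intro translates_independent_Lp[of "{1..m}" t "\<lambda>k. c k * of_real (exp (a * t k / p))" g p]) auto
    then show ?thesis by (simp add: g_def)
  qed
  have "AE y in lborel. y \<in> \<Omega> \<longrightarrow> (\<integral>\<^sup>+s. F (flow A s y) * ennreal (exp (- a * s)) \<partial>lborel) < \<infinity>"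
  proof (rule AE_orbit_finite)
    show "F \<in> borel_measurable borel" unfolding F_def by measurable
    have "integrable lborel (\<lambda>x. norm (\<phi> x) powr p)" using Lp by (simp add: in_Lp_def)
    then show "(\<integral>\<^sup>+x. F x \<partial>lborel) < \<infinity>"
      by (simp add: F_def integrable_iff_bounded)
  qed (use \<tau> a in auto)
  moreover have "AE y in lborel. y \<in> \<Omega>"
  proof -
    have "- \<Omega> \<in> null_sets lborel"
      using \<tau>(2,3) by (auto simp: negligible_iff_null_sets null_sets_completion_iff)
    from AE_not_in[OF this] show ?thesis by simp
  qed
  ultimately have "AE y in lborel. y \<in> UNIV \<longrightarrow> \<phi> y = 0"
    by eventually_elim (use orbit in blast)
  then have "\<phi> y = 0" for y
    using AE_zero_continuous_imp_zero[OF open_UNIV cont] by blast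
  then show False using nz by auto
qed

end
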